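(* Let $m,k$ be positive integers with $3\leq k\leq m^2/2$, let $\Delta$ be a subgraph of $\mathbf{K}_{m,m}$ with exactly $k$ edges, and let $G=\mathrm{S}_m\wr \mathrm{S}_2$, $\widehat{\mathcal{D}}(\Delta)$, $x_i$, $y_j$ be as defined in the context. Then: (a) $\widehat{\mathcal{D}}(\Delta)$ is a $2$-design if and only if the number of $2$-paths in $\Delta$ is $k(k-1)/(m+1)$, or equivalently, $$\sum_{i=1}^m \binom{x_i}{2}+\sum_{j=1}^m \binom{y_j}{2}=\frac{k(k-1)}{m+1}.$$ If this condition holds, then $\widehat{\mathcal{D}}(\Delta)$ is a $2$-$(m^2,k,\lambda)$ design with $$\lambda=\frac{2k(k-1)(m-1)!(m-2)!}{(m+1)|G_\Delta|}.$$ (b) $\widehat{\mathcal{D}}(\Delta)$ is a $3$-design if and only if the condition in part (a) holds and also the following two additional conditions hold: (i) the number of $3$-claws in $\Delta$ is $$\sum_{i=1}^m\binom{x_i}{3}+\sum_{j=1}^m \binom{y_j}{3}=\frac{k(k-1)(k-2)(m-2)}{3(m+1)(m^2-2)};$$ (ii) the number of $3$-paths in $\Delta$ is $$\frac{k(k-1)(k-2)(m-1)}{(m+1)(m^2-2)}.$$ If these conditions hold, then $\widehat{\mathcal{D}}(\Delta)$ is a $3$-$(m^2,k,\lambda)$ design with $$\lambda=\frac{2k(k-1)(k-2)(m-1)!(m-2)!}{(m+1)(m^2-2)|G_\Delta|}.$$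
   Context: Let $\mathcal{R}=\{R_1,\dots,R_m\}$ and $\mathcal{C}=\{C_1,\dots,C_m\}$ be disjoint sets of size $m$, let $\mathcal{P}=\mathcal{R}\times\mathcal{C}$, and let $\mathbf{K}_{m,m}$ be the complete bipartite graph with vertex set $\mathcal{R}\cup\mathcal{C}$ and edges all pairs $\{R,C\}$ with $R\in\mathcal{R}$, $C\in\mathcal{C}$. Subgraphs $\Delta$ of $\mathbf{K}_{m,m}$ are identified with their edge sets (isolated vertices are irrelevant). For a subgraph $\Delta$ put $B(\Delta)=\{(R,C)\in\mathcal{P} : \{R,C\}\text{ is an edge of }\Delta\}$. Let $x_i$ be the number of edges of $\Delta$ incident with $R_i$, and $y_j$ the number of edges of $\Delta$ incident with $C_j$. Let $K=\mathrm{Sym}(\mathcal{R})\times\mathrm{Sym}(\mathcal{C})$ act on $\mathbf{K}_{m,m}$ and on $\mathcal{P}$ in the natural way; let $\tau$ be the automorphism of $\mathbf{K}_{m,m}$ interchanging $R_i$ and $C_i$ for each $i$, which acts on $\mathcal{P}$ by $(R_i,C_j)\mapsto(R_j,C_i)$; and let $G=\langle K,\tau\rangle\cong \mathrm{S}_m\wr\mathrm{S}_2$. $G_\Delta$ is the stabiliser of $\Delta$ in $G$ (equivalently the setwise stabiliser of $B(\Delta)$). Define the incidence structure $\widehat{\mathcal{D}}(\Delta)=(\mathcal{P},\{B(\Delta^g) : g\in G\})$, with incidence being inclusion. An incidence structure with point set $\mathcal{P}$ and blocks that are subsets of $\mathcal{P}$ is a $t$-$(v,k,\lambda)$ design ($t,v,k,\lambda$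 positive integers) if $|\mathcal{P}|=v$, every block has size $k$, and every $t$-subset of $\mathcal{P}$ lies in exactly $\lambda$ blocks; it is a $t$-design if this holds for some $v,k,\lambda$. A $u$-path in $\Delta$ is a (not necessarily induced) subgraph that is a path with $u$ edges and $u+1$ distinct vertices (a path and its reversal are the same). A $3$-claw in $\Delta$ is a subgraph isomorphic to $\mathbf{K}_{1,3}$. *)

theory Defs
  imports Complex_Main "HOL-Combinatorics.Permutations" "HOL-Algebra.Algebra"
begin

type_synonym 'p incidence_structure = "'p set \<times> 'p set set"

definition is_design ::
  "nat \<Rightarrow> nat \<Rightarrow> nat \<Rightarrow> nat \<Rightarrow> 'p incidence_structure \<Rightarrow> bool"
  where "is_design t v k l D \<longleftrightarrow>
    0 < t \<and> 0 < v \<and> 0 < k \<and> 0 < l \<and>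
    card (fst D) = v \<and>
    (\<forall>b \<in> snd D. b \<subseteq> fst D \<and> card b = k) \<and>
    (\<forall>T. T \<subseteq> fst D \<and> card T = t \<longrightarrow> card {b \<in> snd D. T \<subseteq> b} = l)"

definition is_t_design :: "nat \<Rightarrow> 'p incidence_structure \<Rightarrow> bool"
  where "is_t_design t D \<longleftrightarrow> (\<exists>v k l. is_design t v k l D)"


definition complete_bipartite :: "'v set \<Rightarrow> 'v set \<Rightarrow> 'v set set"
  where "complete_bipartite A B = {{a, b} | a b. a \<in> A \<and> b \<in> B}"

text \<open>A path is recorded by its edge set, so a path and its reversal coincide.\<close>

definition is_path :: "nat \<Rightarrow> 'v set set \<Rightarrow> bool"
  where "is_path u E \<longleftrightarrow>
    (\<exists>vs. distinct vs \<and> length vs = u + 1 \<and> E = {{vs ! i, vs ! (i + 1)} | i. i < u})"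

definition is_claw :: "nat \<Rightarrow> 'v set set \<Rightarrow> bool"
  where "is_claw u E \<longleftrightarrow>
    (\<exists>A B. A \<inter> B = {} \<and> card A = 1 \<and> card B = u \<and> E = complete_bipartite A B)"

definition num_paths :: "nat \<Rightarrow> 'v set set \<Rightarrow> nat"
  where "num_paths u \<Delta> = card {E. E \<subseteq> \<Delta> \<and> is_path u E}"

definition num_claws :: "nat \<Rightarrow> 'v set set \<Rightarrow> nat"
  where "num_claws u \<Delta> = card {E. E \<subseteq> \<Delta> \<and> is_claw u E}"

definition vertex_degree :: "'v set set \<Rightarrow> 'v \<Rightarrow> nat"
  where "vertex_degree \<Delta> v = card {e \<in> \<Delta>. v \<in> e}"


datatype vertex = Row nat | Col nat

definition rows :: "nat \<Rightarrow> vertex set"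
  where "rows m = Row ` {1..m}"

definition cols :: "nat \<Rightarrow> vertex set"
  where "cols m = Col ` {1..m}"

definition points :: "nat \<Rightarrow> (vertex \<times> vertex) set"
  where "points m = rows m \<times> cols m"

definition K_graph :: "nat \<Rightarrow> vertex set set"
  where "K_graph m = complete_bipartite (rows m) (cols m)"

text \<open>Permutations of the vertex set \<open>rows m \<union> cols m\<close> are represented, as in
  \<^const>\<open>permutes\<close>, by functions that are the identity outside it.  They
  thus form a subgroup of \<open>BijGroup UNIV\<close>, whose product is composition.\<close>

definition K_group :: "nat \<Rightarrow> (vertex \<Rightarrow> vertex) set"
  where "K_group m = {\<sigma> \<circ> \<pi> | \<sigma> \<pi>. \<sigma> permutes rows m \<and> \<pi> permutes cols m}"

fun tau :: "nat \<Rightarrow> vertex \<Rightarrow> vertex"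
  where
    "tau m (Row i) = (if i \<in> {1..m} then Col i else Row i)"
  | "tau m (Col i) = (if i \<in> {1..m} then Row i else Col i)"

definition G_group :: "nat \<Rightarrow> (vertex \<Rightarrow> vertex) monoid"
  where "G_group m =
    (BijGroup UNIV)\<lparr>carrier := generate (BijGroup UNIV) (K_group m \<union> {tau m})\<rparr>"

definition graph_act :: "(vertex \<Rightarrow> vertex) \<Rightarrow> vertex set set \<Rightarrow> vertex set set"
  where "graph_act g \<Delta> = (\<lambda>e. g ` e) ` \<Delta>"

abbreviation graph_stabilizer :: "nat \<Rightarrow> vertex set set \<Rightarrow> (vertex \<Rightarrow> vertex) set"
  where "graph_stabilizer m \<Delta> \<equiv> stabilizer (G_group m) graph_act \<Delta>"


definition block :: "nat \<Rightarrow> vertex set set \<Rightarrow> (vertex \<times> vertex) set"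
  where "block m \<Delta> = {(r, c) \<in> points m. {r, c} \<in> \<Delta>}"

text \<open>The blocks form a set: subgraphs with equal images contribute one block.\<close>

definition D_hat :: "nat \<Rightarrow> vertex set set \<Rightarrow> (vertex \<times> vertex) incidence_structure"
  where "D_hat m \<Delta> =
    (points m, {block m (graph_act g \<Delta>) | g. g \<in> carrier (G_group m)})"

end

theory Submission
  imports Defs
begin

text \<open>
  Count incidences between the blocks and the \<open>t\<close>-sets of edges in one orbit of \<open>G\<close>: the number
  of blocks through a member of the orbit, times the size of the orbit, is the number of blocks times
  the number of members contained in \<open>\<Delta>\<close>.  So there is a \<open>t\<close>-design iff every orbit meets the
  \<open>t\<close>-subsets of \<open>\<Delta>\<close> in the same proportion, and \<open>\<lambda>\<close> then comes out of the orbit-stabiliser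
  theorem with \<open>|G| = 2 (m!)\<^sup>2\<close>.

  For \<open>t = 2, 3\<close> an orbit is determined by the number of 2-paths in its members, called the colour
  below: 3 for 3-claws, 2 for 3-paths, 1 for a 2-path with a disjoint edge, and 0 for matchings.
  Summing colours over the 3-subsets of \<open>\<Delta>\<close> gives \<open>k - 2\<close> times the number of 2-paths in \<open>\<Delta>\<close>.
  Hence the proportions for 2-paths, 3-claws and 3-paths fix the one for colour 1, and the total
  number of 3-subsets fixes the one for matchings.
\<close>

subsection \<open>The group\<close>

text \<open>That the colour determines the orbit depends on bipartiteness: three pairwise meeting
  edges form a claw or a triangle, and \<open>K_graph m\<close> has no triangle. It also depends on
  \<open>tau m\<close>, which merges configurations centred at a row with those centred at a column;
  under \<open>K_group m\<close> alone, colours 3 and 1 would each split into two orbits. The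
  constants in the conditions are proportions in the complete graph, which has m^2 (m - 1) 2-paths,
  m^2 (m - 1)(m - 2)/3 3-claws and m^2 (m - 1)^2 3-paths. The sum of colours is needed for
  \<open>K_graph m\<close> as well as for \<Delta>, with factors m^2 - 2 and k - 2. For n = m^2 and
  n = k, the factor n - 2 is three times the ratio of \<open>n choose 3\<close> to
  \<open>n choose 2\<close>; this is why the 2-path condition for \<open>t = 2\<close> reappears
  unchanged for \<open>t = 3\<close>.\<close>

text \<open>The product of \<open>BijGroup\<close> is restricted to bijections and is
  \<open>undefined\<close> elsewhere; bijectivity of both factors is what allows it to be replaced
  by plain composition.\<close>

lemma mult_BijGroup_UNIV:
  assumes "bij f" "bij g"
  shows "f \<otimes>\<^bsub>BijGroup UNIV\<^esub> g = f \<circ> g"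
  using assms by (simp add: BijGroup_def Bij_def compose_def fun_eq_iff)

lemma carrier_BijGroup_UNIV: "carrier (BijGroup UNIV) = {f. bij f}"
  by (simp add: BijGroup_def Bij_def)

lemma one_BijGroup_UNIV: "\<one>\<^bsub>BijGroup UNIV\<^esub> = id"
  by (simp add: BijGroup_def fun_eq_iff)

lemma inv_BijGroup_UNIV:
  assumes "bij f"
  shows "inv\<^bsub>BijGroup UNIV\<^esub> f = inv_into UNIV f"
proof -
  interpret group "BijGroup UNIV" by (rule group_BijGroup)
  show ?thesis
    using assms bij_imp_bij_inv[OF assms]
    by (intro inv_equality)
       (simp_all add: mult_BijGroup_UNIV carrier_BijGroup_UNIV one_BijGroup_UNIV bij_is_inj)
qed

lemma finite_rows [simp]: "finite (rows m)" and finite_cols [simp]: "finite (cols m)"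
  by (simp_all add: rows_def cols_def)

lemma card_rows [simp]: "card (rows m) = m" and card_cols [simp]: "card (cols m) = m"
  by (simp_all add: rows_def cols_def card_image inj_on_def)

lemma rows_Int_cols [simp]: "rows m \<inter> cols m = {}"
  by (auto simp: rows_def cols_def)

lemma Row_in_rows [simp]: "Row i \<in> rows m \<longleftrightarrow> i \<in> {1..m}"
  and Col_in_cols [simp]: "Col i \<in> cols m \<longleftrightarrow> i \<in> {1..m}"
  and Row_notin_cols [simp]: "Row i \<notin> cols m"
  and Col_notin_rows [simp]: "Col i \<notin> rows m"
  by (auto simp: rows_def cols_def)

text \<open>The permutations that respect the bipartition. This is an explicit form of the group
  that \<open>G_group\<close> specifies by generators; later arguments work with it instead of
  \<open>generate\<close>.\<close>

definition part_auts :: "nat \<Rightarrow> (vertex \<Rightarrow> vertex) set"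
  where "part_auts m =
    {g. g permutes rows m \<union> cols m \<and> (g ` rows m = rows m \<or> g ` rows m = cols m)}"

lemma image_cols_eq:
  assumes "g permutes rows m \<union> cols m"
  shows "g ` cols m = (rows m \<union> cols m) - g ` rows m"
proof -
  have "cols m = (rows m \<union> cols m) - rows m"
    using rows_Int_cols by blast
  then have "g ` cols m = g ` (rows m \<union> cols m) - g ` rows m"
    using permutes_inj[OF assms] by (metis image_set_diff)
  with permutes_image[OF assms] show ?thesis by simp
qed

lemma image_cols_cases:
  assumes "g \<in> part_auts m"
  shows "g ` rows m = rows m \<and> g ` cols m = cols m \<or> g ` rows m = cols m \<and> g ` cols m = rows m"
proof -
  have "(rows m \<union> cols m) - rows m = cols m" "(rows m \<union> cols m) - cols m = rows m"
    using rows_Int_cols[of m] by (auto simp del: rows_Int_cols)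
  moreover have "g permutes rows m \<union> cols m" "g ` rows m = rows m \<or> g ` rows m = cols m"
    using assms by (simp_all add: part_auts_def)
  ultimately show ?thesis
    using image_cols_eq[of g m] by (elim disjE) simp_all
qed

lemma tau_tau [simp]: "tau m (tau m v) = v"
  by (cases v) auto

lemma tau_comp_tau [simp]: "tau m \<circ> tau m = id"
  by (simp add: fun_eq_iff)

lemma image_tau [simp]: "tau m ` rows m = cols m" "tau m ` cols m = rows m"
  by (force simp: rows_def cols_def image_image)+

lemma tau_in_part_auts: "tau m \<in> part_auts m"
proof -
  have "tau m permutes rows m \<union> cols m"
    unfolding permutes_def
  proof (intro conjI allI impI)
    show "tau m v = v" if "v \<notin> rows m \<union> cols m" for v
      using that by (cases v) auto
    show "\<exists>!v. tau m v = w" for w by (metis tau_tau)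
  qed
  then show ?thesis by (simp add: part_auts_def)
qed

lemma bij_part_auts: "g \<in> part_auts m \<Longrightarrow> bij g"
  by (auto simp: part_auts_def permutes_bij)

lemma part_auts_comp:
  assumes "g \<in> part_auts m" "h \<in> part_auts m"
  shows "g \<circ> h \<in> part_auts m"
proof -
  have "g permutes rows m \<union> cols m" "h permutes rows m \<union> cols m"
    using assms unfolding part_auts_def by simp_all
  then have "g \<circ> h permutes rows m \<union> cols m" by (rule permutes_compose[rotated])
  moreover have "(g \<circ> h) ` rows m = rows m \<or> (g \<circ> h) ` rows m = cols m"
    using image_cols_cases[OF assms(1)] image_cols_cases[OF assms(2)]
    unfolding image_comp[symmetric] by (elim disjE conjE) simp_all
  ultimately show ?thesis
    unfolding part_auts_def by (intro CollectI conjI)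
qed

lemma part_auts_inv:
  assumes "g \<in> part_auts m"
  shows "inv_into UNIV g \<in> part_auts m"
proof -
  have inv: "inv_into UNIV g ` g ` A = A" for A
    using bij_is_inj[OF bij_part_auts[OF assms]] by (rule image_inv_f_f)
  have "inv_into UNIV g ` rows m = rows m \<or> inv_into UNIV g ` rows m = cols m"
    using image_cols_cases[OF assms]
    by (elim disjE conjE) (use inv[of "rows m"] inv[of "cols m"] in simp_all)
  moreover have "inv_into UNIV g permutes rows m \<union> cols m"
    using assms unfolding part_auts_def by (simp add: permutes_inv)
  ultimately show ?thesis
    unfolding part_auts_def by (intro CollectI conjI)
qed

lemma K_group_eq: "K_group m = {g. g permutes rows m \<union> cols m \<and> g ` rows m = rows m}"
proof (intro equalityI subsetI)
  fix g assume "g \<in> K_group m"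
  then obtain \<sigma> \<pi> where g: "g = \<sigma> \<circ> \<pi>" "\<sigma> permutes rows m" "\<pi> permutes cols m"
    by (auto simp: K_group_def)
  have "\<pi> v = v" if "v \<in> rows m" for v
    using that g(3) rows_Int_cols by (meson disjoint_iff permutes_not_in)
  then have "\<pi> ` rows m = rows m" by simp
  moreover have "\<sigma> permutes rows m \<union> cols m" "\<pi> permutes rows m \<union> cols m"
    using g by (auto intro: permutes_subset)
  moreover have "(\<sigma> \<circ> \<pi>) ` rows m = \<sigma> ` \<pi> ` rows m" by (rule image_comp[symmetric])
  ultimately show "g \<in> {g. g permutes rows m \<union> cols m \<and> g ` rows m = rows m}"
    using g by (simp add: permutes_compose permutes_image del: image_comp)
next
  fix g assume "g \<in> {g. g permutes rows m \<union> cols m \<and> g ` rows m = rows m}"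
  then have g: "g permutes rows m \<union> cols m" "g ` rows m = rows m" by auto
  \<comment> \<open>The two factors are \<open>g\<close> on one part, extended by the identity;
    since \<open>g\<close> keeps each part, their composition is \<open>g\<close>.\<close>
  define \<sigma> where "\<sigma> v = (if v \<in> rows m then g v else v)" for v
  define \<pi> where "\<pi> v = (if v \<in> cols m then g v else v)" for v
  have gc: "g ` cols m = cols m"
    using image_cols_eq[OF g(1)] g(2) rows_Int_cols by blast
  have inj: "inj_on g A" for A using permutes_inj[OF g(1)] by (rule inj_on_subset) simp
  have "\<sigma> permutes rows m"
    by (rule bij_imp_permutes) (use g inj in \<open>auto simp: \<sigma>_def bij_betw_def inj_on_def\<close>)
  moreover have "\<pi> permutes cols m"
    by (rule bij_imp_permutes) (use gc inj in \<open>auto simp: \<pi>_def bij_betw_def inj_on_def\<close>)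
  moreover have "g = \<sigma> \<circ> \<pi>"
  proof
    fix v
    have "g v \<notin> rows m" if "v \<in> cols m" using that gc rows_Int_cols by blast
    moreover have "v \<notin> cols m" if "v \<in> rows m" using that rows_Int_cols by blast
    ultimately show "g v = (\<sigma> \<circ> \<pi>) v"
      using permutes_not_in[OF g(1)] by (auto simp: \<sigma>_def \<pi>_def)
  qed
  ultimately show "g \<in> K_group m" by (auto simp: K_group_def)
qed

text \<open>Since \<open>tau m\<close> is an involution exchanging the parts, an element that swaps
  them enters \<open>K_group m\<close> after composition with \<open>tau m\<close>.\<close>

lemma part_auts_eq: "part_auts m = K_group m \<union> (\<circ>) (tau m) ` K_group m"
proof (intro equalityI subsetI)
  fix g assume g: "g \<in> part_auts m"
  show "g \<in> K_group m \<union> (\<circ>) (tau m) ` K_group m"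
  proof (cases "g ` rows m = rows m")
    case False
    have "(tau m \<circ> g) ` rows m = rows m"
      unfolding image_comp[symmetric]
      using False image_cols_cases[OF g] by (elim disjE conjE) simp_all
    then have "tau m \<circ> g \<in> K_group m"
      using part_auts_comp[OF tau_in_part_auts g] by (simp add: K_group_eq part_auts_def)
    moreover have "g = tau m \<circ> (tau m \<circ> g)" by (simp add: comp_assoc[symmetric])
    ultimately show ?thesis by blast
  qed (use g in \<open>auto simp: part_auts_def K_group_eq\<close>)
next
  have "K_group m \<subseteq> part_auts m" by (auto simp: K_group_eq part_auts_def)
  then show "g \<in> part_auts m" if "g \<in> K_group m \<union> (\<circ>) (tau m) ` K_group m" for g
    using that part_auts_comp[OF tau_in_part_auts] by blast
qed

lemma subgroup_part_auts: "subgroup (part_auts m) (BijGroup UNIV)"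
proof (intro group.subgroupI[OF group_BijGroup])
  show "part_auts m \<noteq> {}" using tau_in_part_auts by blast
qed (auto simp: carrier_BijGroup_UNIV bij_part_auts inv_BijGroup_UNIV part_auts_inv
      mult_BijGroup_UNIV part_auts_comp)

text \<open>One inclusion is minimality of the generated subgroup; for the other, every element is a
  generator or a product of two generators.\<close>

lemma carrier_G_group: "carrier (G_group m) = part_auts m"
proof -
  interpret B: group "BijGroup (UNIV :: vertex set)" by (rule group_BijGroup)
  let ?S = "K_group m \<union> {tau m}"
  have S: "?S \<subseteq> part_auts m"
    using tau_in_part_auts part_auts_eq by auto
  have "part_auts m \<subseteq> generate (BijGroup UNIV) ?S"
  proof
    fix g assume "g \<in> part_auts m"
    then consider "g \<in> K_group m" | h where "h \<in> K_group m" "g = tau m \<circ> h"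
      using part_auts_eq by blast
    then show "g \<in> generate (BijGroup UNIV) ?S"
    proof cases
      case 2
      then have "g = tau m \<otimes>\<^bsub>BijGroup UNIV\<^esub> h"
        using S bij_part_auts by (subst mult_BijGroup_UNIV) auto
      then show ?thesis
        using 2(1) generate.eng[of "tau m" "BijGroup UNIV" ?S h] generate.incl[of _ ?S "BijGroup UNIV"]
        by simp
    qed (auto intro: generate.incl)
  qed
  with B.generate_subgroup_incl[OF S subgroup_part_auts] show ?thesis
    by (simp add: G_group_def)
qed

lemma group_G_group: "group (G_group m)"
  using subgroup.subgroup_is_group[OF subgroup_part_auts group_BijGroup]
    carrier_G_group[of m] by (simp add: G_group_def)

section \<open>Action on edge sets and the order of the group\<close>

lemma graph_act_comp: "graph_act (f \<circ> h) \<Gamma> = graph_act f (graph_act h \<Gamma>)"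
  by (simp add: graph_act_def image_image image_comp)

lemma graph_act_inv:
  assumes "bij g"
  shows "graph_act (inv_into UNIV g) (graph_act g \<Gamma>) = \<Gamma>"
    and "graph_act g (graph_act (inv_into UNIV g) \<Gamma>) = \<Gamma>"
  using assms
  by (simp_all add: graph_act_comp[symmetric] bij_is_inj bij_is_surj surj_iff[THEN iffD1])
     (simp_all add: graph_act_def)

lemma inj_graph_act: "bij g \<Longrightarrow> inj (graph_act g)"
  by (rule inj_on_inverseI[where g = "graph_act (inv_into UNIV g)"]) (rule graph_act_inv)

lemma bij_graph_act: "bij g \<Longrightarrow> bij (graph_act g)"
  by (rule bijI, erule inj_graph_act, rule surjI, erule graph_act_inv)

text \<open>The set acted on is \<open>UNIV\<close>, all edge sets, so the target group is again
  \<open>BijGroup UNIV\<close> with composition as its product, and the orbit-stabiliser theorem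
  applies to every \<Delta>.\<close>

lemma group_action_graph: "group_action (G_group m) UNIV graph_act"
proof -
  have hom: "graph_act \<in> hom (G_group m) (BijGroup UNIV)"
  proof (rule homI)
    fix g h assume "g \<in> carrier (G_group m)" "h \<in> carrier (G_group m)"
    then have b: "bij g" "bij h" by (simp_all add: carrier_G_group bij_part_auts)
    then have "g \<otimes>\<^bsub>G_group m\<^esub> h = g \<circ> h"
      by (simp add: G_group_def mult_BijGroup_UNIV)
    moreover have "graph_act (g \<circ> h) = graph_act g \<circ> graph_act h"
      by (simp add: fun_eq_iff graph_act_comp)
    ultimately show "graph_act (g \<otimes>\<^bsub>G_group m\<^esub> h) = graph_act g \<otimes>\<^bsub>BijGroup UNIV\<^esub> graph_act h"
      using b by (simp add: mult_BijGroup_UNIV bij_graph_act)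
  qed (simp add: carrier_BijGroup_UNIV carrier_G_group bij_graph_act bij_part_auts)
  show ?thesis
    by (intro group_action.intro group_hom.intro group_hom_axioms.intro group_G_group group_BijGroup hom)
qed

lemma card_K_group: "card (K_group m) = fact m ^ 2"
proof -
  let ?P = "{\<sigma>. \<sigma> permutes rows m} \<times> {\<pi>. \<pi> permutes cols m}"
  have "inj_on (\<lambda>(\<sigma>, \<pi>). \<sigma> \<circ> \<pi>) ?P"
  proof (rule inj_onI, clarify)
    fix \<sigma> \<pi> \<sigma>' \<pi>'
    assume p: "\<sigma> permutes rows m" "\<pi> permutes cols m" "\<sigma>' permutes rows m" "\<pi>' permutes cols m"
      and eq: "\<sigma> \<circ> \<pi> = \<sigma>' \<circ> \<pi>'"
    \<comment> \<open>The product agrees with the first factor on rows and with the second on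
      columns, because each factor fixes the other part pointwise. Hence it determines both.\<close>
    have r: "\<sigma> v = (if v \<in> rows m then (\<sigma> \<circ> \<pi>) v else v)"
      and c: "\<pi> v = (if v \<in> cols m then (\<sigma> \<circ> \<pi>) v else v)"
      if "\<sigma> permutes rows m" "\<pi> permutes cols m" for \<sigma> \<pi> v
    proof -
      have d: "\<And>w. w \<in> cols m \<Longrightarrow> w \<notin> rows m" using rows_Int_cols by blast
      show "\<sigma> v = (if v \<in> rows m then (\<sigma> \<circ> \<pi>) v else v)"
        using d permutes_not_in[OF that(1)] permutes_not_in[OF that(2)]
        by (cases "v \<in> cols m") auto
      show "\<pi> v = (if v \<in> cols m then (\<sigma> \<circ> \<pi>) v else v)"
        using d permutes_in_image[OF that(2)] permutes_not_in[OF that(1)] permutes_not_in[OF that(2)]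
        by (cases "v \<in> cols m") auto
    qed
    have "\<sigma> v = \<sigma>' v" for v
      using r[OF p(1,2), of v] r[OF p(3,4), of v] unfolding eq by (rule trans[OF _ sym])
    moreover have "\<pi> v = \<pi>' v" for v
      using c[OF p(1,2), of v] c[OF p(3,4), of v] unfolding eq by (rule trans[OF _ sym])
    ultimately show "\<sigma> = \<sigma>' \<and> \<pi> = \<pi>'" by blast
  qed
  moreover have "K_group m = (\<lambda>(\<sigma>, \<pi>). \<sigma> \<circ> \<pi>) ` ?P"
    by (auto simp: K_group_def)
  ultimately show ?thesis
    by (simp add: card_image card_cartesian_product card_permutations power2_eq_square)
qed

text \<open>Composition with \<open>tau m\<close> is injective, so the two cosets of
  \<open>K_group m\<close> have equal size. They are disjoint because \<open>rows m\<close> and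
  \<open>cols m\<close> differ; for m = 0 both parts are empty and the cosets coincide.\<close>

lemma order_G_group:
  assumes "0 < m"
  shows "order (G_group m) = 2 * fact m ^ 2"
proof -
  have fin: "finite (K_group m)"
    by (rule card_ge_0_finite) (simp add: card_K_group)
  have "inj ((\<circ>) (tau m))"
    by (rule injI) (metis comp_assoc id_comp tau_comp_tau)
  then have "card ((\<circ>) (tau m) ` K_group m) = fact m ^ 2"
    by (metis card_K_group card_image inj_on_subset subset_UNIV)
  moreover have "K_group m \<inter> (\<circ>) (tau m) ` K_group m = {}"
  proof -
    have "cols m \<noteq> rows m"
      using assms Row_in_rows[of 1 m] Row_notin_cols[of 1 m] by force
    moreover have "(tau m \<circ> h) ` rows m = cols m" if "h \<in> K_group m" for h
      unfolding image_comp[symmetric] using that by (simp add: K_group_eq)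
    ultimately have "tau m \<circ> h \<notin> K_group m" if "h \<in> K_group m" for h
      using that unfolding K_group_eq by simp
    then show ?thesis by blast
  qed
  ultimately show ?thesis
    using fin by (simp add: order_def carrier_G_group part_auts_eq card_Un_disjoint card_K_group)
qed

definition graph_orbit :: "nat \<Rightarrow> vertex set set \<Rightarrow> vertex set set set"
  where "graph_orbit m \<Delta> = {graph_act g \<Delta> | g. g \<in> part_auts m}"

lemma card_graph_orbit:
  assumes "0 < m"
  shows "card (graph_orbit m \<Delta>) * card (graph_stabilizer m \<Delta>) = 2 * fact m ^ 2"
  using group_action.orbit_stabilizer_theorem[OF group_action_graph, of \<Delta> m] order_G_group[OF assms]
  by (simp add: Group_Action.orbit_def graph_orbit_def carrier_G_group)

subsection \<open>Block counts in a homogeneous family\<close>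

text \<open>The group is replaced by two of its consequences: all blocks contain equally many
  \<open>t\<close>-sets of each colour, and \<open>t\<close>-sets of equal colour lie in equally
  many blocks. What follows is pure double counting.\<close>

locale homogeneous_family =
  fixes E :: "'a set" and \<B> :: "'a set set" and t k :: nat
    and colour :: "'a set \<Rightarrow> nat" and n :: "nat \<Rightarrow> nat"
  assumes finite_E: "finite E" and finite_family: "finite \<B>" and nonempty_family: "\<B> \<noteq> {}"
    and block_subset: "b \<in> \<B> \<Longrightarrow> b \<subseteq> E" and card_block: "b \<in> \<B> \<Longrightarrow> card b = k"
    and colour_count: "b \<in> \<B> \<Longrightarrow> card {T. T \<subseteq> b \<and> card T = t \<and> colour T = j} = n j"
    and homogeneous: "S \<subseteq> E \<Longrightarrow> T \<subseteq> E \<Longrightarrow> card S = t \<Longrightarrow> card T = t \<Longrightarrow> colour S = colour T \<Longrightarrow>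
      card {b \<in> \<B>. S \<subseteq> b} = card {b \<in> \<B>. T \<subseteq> b}"
begin

text \<open>Both sides count pairs of a block and a \<open>t\<close>-set inside it. The predicate
  \<open>P\<close> is left open: fixing a colour gives the identity for one class, the trivial
  predicate gives the replication number.\<close>

lemma double_count:
  assumes const: "\<And>T. T \<subseteq> E \<Longrightarrow> card T = t \<Longrightarrow> P T \<Longrightarrow> card {b \<in> \<B>. T \<subseteq> b} = l"
    and count: "\<And>b. b \<in> \<B> \<Longrightarrow> card {T. T \<subseteq> b \<and> card T = t \<and> P T} = q"
  shows "l * card {T. T \<subseteq> E \<and> card T = t \<and> P T} = card \<B> * q"
proof -
  let ?\<T> = "{T. T \<subseteq> E \<and> card T = t \<and> P T}"
  have "{T \<in> ?\<T>. T \<subseteq> b} = {T. T \<subseteq> b \<and> card T = t \<and> P T}" if "b \<in> \<B>" for b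
    using block_subset[OF that] by auto
  then have "(\<Sum>T\<in>?\<T>. card {b \<in> \<B>. T \<subseteq> b}) = (\<Sum>b\<in>\<B>. q)"
    using finite_E finite_family count by (intro sum_multicount_gen) auto
  moreover have "(\<Sum>T\<in>?\<T>. card {b \<in> \<B>. T \<subseteq> b}) = (\<Sum>T\<in>?\<T>. l)"
    using const by (intro sum.cong) auto
  ultimately show ?thesis by (simp add: mult.commute)
qed

lemma replication_times_class:
  assumes "T \<subseteq> E" "card T = t"
  shows "card {b \<in> \<B>. T \<subseteq> b} * card {S. S \<subseteq> E \<and> card S = t \<and> colour S = colour T}
    = card \<B> * n (colour T)"
  using assms by (intro double_count homogeneous colour_count) auto

lemma replication_number:
  assumes "\<And>T. T \<subseteq> E \<Longrightarrow> card T = t \<Longrightarrow> card {b \<in> \<B>. T \<subseteq> b} = l"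
  shows "l * (card E choose t) = card \<B> * (k choose t)"
proof -
  have "l * card {T. T \<subseteq> E \<and> card T = t \<and> True} = card \<B> * (k choose t)"
  proof (rule double_count)
    show "card {T. T \<subseteq> b \<and> card T = t \<and> True} = k choose t" if "b \<in> \<B>" for b
      using that finite_subset[OF block_subset finite_E] by (simp add: n_subsets card_block)
  qed (rule assms)
  with finite_E show ?thesis by (simp add: n_subsets)
qed

text \<open>Comparing the identity for one colour class with the identity for all
  \<open>t\<close>-sets eliminates the unknown replication number. Conversely, inserting the
  proportions into the class identity makes the number of blocks through a \<open>t\<close>-set
  independent of its colour.\<close>

lemma balanced_iff:
  assumes "t \<le> card E"
  shows "(\<exists>l. \<forall>T. T \<subseteq> E \<and> card T = t \<longrightarrow> card {b \<in> \<B>. T \<subseteq> b} = l) \<longleftrightarrow>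
    (\<forall>j. n j * (card E choose t) = (k choose t) * card {T. T \<subseteq> E \<and> card T = t \<and> colour T = j})"
    (is "?L \<longleftrightarrow> (\<forall>j. _ = _ * ?N j)")
proof -
  have pos: "0 < card E choose t" "0 < card \<B>"
    using assms finite_family nonempty_family by (simp_all add: card_gt_0_iff)
  show ?thesis
  proof
    assume ?L
    then obtain l where l: "\<And>T. T \<subseteq> E \<Longrightarrow> card T = t \<Longrightarrow> card {b \<in> \<B>. T \<subseteq> b} = l" by auto
    show "\<forall>j. n j * (card E choose t) = (k choose t) * ?N j"
    proof
      fix j
      have "l * ?N j = card \<B> * n j"
        using l colour_count by (intro double_count) auto
      then have "card \<B> * (n j * (card E choose t)) = (l * (card E choose t)) * ?N j"
        by (simp add: mult_ac)
      also have "\<dots> = card \<B> * ((k choose t) * ?N j)"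
        using replication_number[OF l] by simp
      finally have "card \<B> * (n j * (card E choose t)) = card \<B> * ((k choose t) * ?N j)" .
      with pos show "n j * (card E choose t) = (k choose t) * ?N j" by simp
    qed
  next
    assume eq: "\<forall>j. n j * (card E choose t) = (k choose t) * ?N j"
    have key: "card {b \<in> \<B>. T \<subseteq> b} * (card E choose t) = card \<B> * (k choose t)"
      if T: "T \<subseteq> E" "card T = t" for T
    proof -
      have "finite {S. S \<subseteq> E \<and> card S = t \<and> colour S = colour T}"
        using finite_E by simp
      \<comment> \<open>\<open>T\<close> lies in its own colour class, so the size of that class is
        positive and can be cancelled at the end.\<close>
      with T have "0 < ?N (colour T)" by (auto simp: card_gt_0_iff)
      moreover have "card {b \<in> \<B>. T \<subseteq> b} * ?N (colour T) = card \<B> * n (colour T)"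
        using replication_times_class[OF T] .
      then have "?N (colour T) * (card {b \<in> \<B>. T \<subseteq> b} * (card E choose t)) =
          card \<B> * (n (colour T) * (card E choose t))"
        by (simp add: mult_ac)
      then have "?N (colour T) * (card {b \<in> \<B>. T \<subseteq> b} * (card E choose t)) =
          ?N (colour T) * (card \<B> * (k choose t))"
        unfolding eq[rule_format] by (simp only: mult_ac)
      ultimately show ?thesis by simp
    qed
    \<comment> \<open>Any fixed \<open>t\<close>-set can supply the common value; one exists because
      \<open>t\<close> is at most \<open>card E\<close>.\<close>
    obtain T0 where "T0 \<subseteq> E" "card T0 = t"
      using obtain_subset_with_card_n[OF assms] by metis
    then have "card {b \<in> \<B>. T \<subseteq> b} = card {b \<in> \<B>. T0 \<subseteq> b}" if "T \<subseteq> E" "card T = t" for T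
      using key[OF that] key[of T0] pos
        mult_cancel2[of "card {b \<in> \<B>. T \<subseteq> b}" "card E choose t" "card {b \<in> \<B>. T0 \<subseteq> b}"] by simp
    then show ?L by (intro exI[of _ "card {b \<in> \<B>. T0 \<subseteq> b}"]) simp
  qed
qed

end

subsection \<open>The incidence structure\<close>

lemma mem_K_graph: "e \<in> K_graph m \<longleftrightarrow> (\<exists>i\<in>{1..m}. \<exists>j\<in>{1..m}. e = {Row i, Col j})"
  by (auto simp: K_graph_def complete_bipartite_def rows_def cols_def)

text \<open>Turns a point, an ordered pair, into an unordered edge; it moves the counting from
  \<open>points m\<close> to \<open>K_graph m\<close>.\<close>

definition edge_of :: "'v \<times> 'v \<Rightarrow> 'v set"
  where "edge_of p = {fst p, snd p}"

lemma bij_betw_points_K_graph: "bij_betw edge_of (points m) (K_graph m)"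
  unfolding bij_betw_def inj_on_def edge_of_def points_def rows_def cols_def
  by (auto simp: doubleton_eq_iff mem_K_graph image_iff)

lemma finite_points [simp]: "finite (points m)" and card_points [simp]: "card (points m) = m ^ 2"
  by (simp_all add: points_def card_cartesian_product power2_eq_square)

lemma finite_K_graph [simp]: "finite (K_graph m)" and card_K_graph [simp]: "card (K_graph m) = m ^ 2"
  using bij_betw_finite[OF bij_betw_points_K_graph, of m]
    bij_betw_same_card[OF bij_betw_points_K_graph, of m] by simp_all

lemma block_eq: "block m \<Gamma> = {p \<in> points m. edge_of p \<in> \<Gamma>}"
  by (auto simp: block_def edge_of_def)

lemma image_block:
  assumes "\<Gamma> \<subseteq> K_graph m"
  shows "edge_of ` block m \<Gamma> = \<Gamma>"
proof (intro equalityI subsetI)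
  fix e assume "e \<in> \<Gamma>"
  with assms have "e \<in> edge_of ` points m"
    using bij_betw_imp_surj_on[OF bij_betw_points_K_graph, of m] by auto
  with \<open>e \<in> \<Gamma>\<close> show "e \<in> edge_of ` block m \<Gamma>" by (auto simp: block_eq)
qed (auto simp: block_eq)

lemma card_block_eq:
  assumes "\<Gamma> \<subseteq> K_graph m"
  shows "card (block m \<Gamma>) = card \<Gamma>"
proof -
  have "inj_on edge_of (block m \<Gamma>)"
    using bij_betw_imp_inj_on[OF bij_betw_points_K_graph[of m]]
    by (rule inj_on_subset) (auto simp: block_def)
  from card_image[OF this] image_block[OF assms] show ?thesis by simp
qed

lemma part_auts_edge:
  assumes "g \<in> part_auts m" "e \<in> K_graph m"
  shows "g ` e \<in> K_graph m"
proof -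
  obtain r c where e: "e = {r, c}" "r \<in> rows m" "c \<in> cols m"
    using assms(2) by (auto simp: K_graph_def complete_bipartite_def)
  with image_cols_cases[OF assms(1)]
  consider "g r \<in> rows m" "g c \<in> cols m" | "g c \<in> rows m" "g r \<in> cols m" by blast
  then show ?thesis
    by cases (use e in \<open>auto simp: K_graph_def complete_bipartite_def insert_commute\<close>)
qed

lemma graph_act_subset:
  assumes "g \<in> part_auts m" "\<Gamma> \<subseteq> K_graph m"
  shows "graph_act g \<Gamma> \<subseteq> K_graph m"
  using assms part_auts_edge by (auto simp: graph_act_def)

lemma inj_image: "inj g \<Longrightarrow> inj ((`) g)"
  by (rule injI) (simp add: inj_image_eq_iff)

lemma card_graph_act: "bij g \<Longrightarrow> card (graph_act g \<Gamma>) = card \<Gamma>"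
  unfolding graph_act_def
  by (rule card_image) (rule inj_on_subset[OF inj_image[OF bij_is_inj] subset_UNIV])

lemma graph_act_mono_iff: "bij g \<Longrightarrow> graph_act g S \<subseteq> graph_act g T \<longleftrightarrow> S \<subseteq> T"
  unfolding graph_act_def by (rule inj_image_subset_iff) (rule inj_image[OF bij_is_inj])

lemma graph_orbit_self: "\<Delta> \<in> graph_orbit m \<Delta>"
proof -
  have "id \<in> part_auts m" by (simp add: part_auts_def permutes_id)
  moreover have "\<Delta> = graph_act id \<Delta>" by (simp add: graph_act_def)
  ultimately show ?thesis unfolding graph_orbit_def by (intro CollectI exI conjI)
qed

lemma graph_orbit_subset:
  assumes "\<Delta> \<subseteq> K_graph m" "b \<in> graph_orbit m \<Delta>"
  shows "b \<subseteq> K_graph m" and "card b = card \<Delta>"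
  using assms by (auto simp: graph_orbit_def card_graph_act bij_part_auts dest: graph_act_subset[THEN subsetD])

text \<open>\<open>edge_of\<close> recovers a graph from its block, so \<open>block m\<close> is
  injective on the orbit and distinct graphs are never merged into one block. The value of
  \<open>k\<close> is forced because the orbit contains \<Delta> and is therefore nonempty.\<close>

lemma D_hat_design_iff:
  assumes "0 < m" "0 < t" "0 < card \<Delta>" "\<Delta> \<subseteq> K_graph m"
  shows "is_design t v k l (D_hat m \<Delta>) \<longleftrightarrow> v = m ^ 2 \<and> k = card \<Delta> \<and> 0 < l \<and>
    (\<forall>T. T \<subseteq> K_graph m \<and> card T = t \<longrightarrow> card {b \<in> graph_orbit m \<Delta>. T \<subseteq> b} = l)"
proof -
  let ?\<B> = "graph_orbit m \<Delta>"
  note bij = bij_betw_points_K_graph[of m]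
  have D: "D_hat m \<Delta> = (points m, block m ` ?\<B>)"
    by (auto simp: D_hat_def graph_orbit_def carrier_G_group)
  have sub: "b \<subseteq> K_graph m" "card b = card \<Delta>" if "b \<in> ?\<B>" for b
    using graph_orbit_subset[OF assms(4) that] .
  have inj: "inj_on (block m) ?\<B>"
    by (rule inj_on_inverseI[of _ "(`) edge_of"]) (use sub image_block in auto)
  note ne = graph_orbit_self[of \<Delta> m]
  have blk: "b \<subseteq> points m \<and> card b = card \<Delta>" if "b \<in> block m ` ?\<B>" for b
    using that sub card_block_eq by (auto simp: block_def)
  have count: "card {b \<in> block m ` ?\<B>. T \<subseteq> b} = card {b \<in> ?\<B>. edge_of ` T \<subseteq> b}" if "T \<subseteq> points m" for T
  proof -
    have "{b \<in> block m ` ?\<B>. T \<subseteq> b} = block m ` {b \<in> ?\<B>. edge_of ` T \<subseteq> b}"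
      using that by (auto simp: block_eq)
    with card_image[OF inj_on_subset[OF inj]] show ?thesis by (simp add: subset_iff)
  qed
  have "(\<forall>T. T \<subseteq> points m \<and> card T = t \<longrightarrow> card {b \<in> ?\<B>. edge_of ` T \<subseteq> b} = l) \<longleftrightarrow>
    (\<forall>T. T \<subseteq> K_graph m \<and> card T = t \<longrightarrow> card {b \<in> ?\<B>. T \<subseteq> b} = l)" (is "?L \<longleftrightarrow> ?R")
  proof
    assume L: ?L
    show ?R
    proof (intro allI impI, elim conjE)
      fix T assume T: "T \<subseteq> K_graph m" "card T = t"
      then have "block m T \<subseteq> points m" "card (block m T) = t" "edge_of ` block m T = T"
        using card_block_eq image_block by (auto simp: block_def)
      with L[rule_format, of "block m T"] show "card {b \<in> ?\<B>. T \<subseteq> b} = l" by simp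
    qed
  next
    assume R: ?R
    show ?L
    proof (intro allI impI, elim conjE)
      fix T assume T: "T \<subseteq> points m" "card T = t"
      then have "edge_of ` T \<subseteq> K_graph m"
        using image_mono[OF T(1), of edge_of] bij_betw_imp_surj_on[OF bij] by simp
      moreover have "card (edge_of ` T) = t"
        using card_image[OF inj_on_subset[OF bij_betw_imp_inj_on[OF bij] T(1)]] T(2) by simp
      ultimately show "card {b \<in> ?\<B>. edge_of ` T \<subseteq> b} = l"
        using R[rule_format, of "edge_of ` T"] by simp
    qed
  qed
  moreover have "(\<forall>T. T \<subseteq> points m \<and> card T = t \<longrightarrow> card {b \<in> block m ` ?\<B>. T \<subseteq> b} = l) \<longleftrightarrow> ?L"
    using count by (intro all_cong1 imp_cong refl) simp
  moreover have "(\<forall>b \<in> block m ` ?\<B>. b \<subseteq> points m \<and> card b = k) \<longleftrightarrow> k = card \<Delta>"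
    using ne blk by (metis imageI)
  ultimately show ?thesis
    using assms unfolding is_design_def D fst_conv snd_conv card_points by auto
qed

subsection \<open>Claws and paths\<close>

text \<open>A vertex common to all edges is the centre, and the leaves are the opposite ends. The
  existential over vertex sets becomes an intersection condition that can be evaluated on explicit
  edges.\<close>

lemma is_claw_iff:
  assumes edges: "\<And>e. e \<in> S \<Longrightarrow> card e = 2" and "0 < u"
  shows "is_claw u S \<longleftrightarrow> card S = u \<and> \<Inter> S \<noteq> {}"
proof -
  have card_star: "card (complete_bipartite {a} B) = card B" if "a \<notin> B" for a :: 'a and B
  proof -
    have "complete_bipartite {a} B = (\<lambda>b. {a, b}) ` B"
      by (auto simp: complete_bipartite_def)
    moreover have "inj_on (\<lambda>b. {a, b}) B"
      by (auto simp: inj_on_def doubleton_eq_iff)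
    ultimately show ?thesis by (simp add: card_image)
  qed
  show ?thesis
  proof
    assume "is_claw u S"
    then obtain A B where AB: "A \<inter> B = {}" "card A = 1" "card B = u" "S = complete_bipartite A B"
      by (auto simp: is_claw_def)
    from \<open>card A = 1\<close> obtain a where "A = {a}" by (rule card_1_singletonE)
    with AB have "card S = u" using card_star by auto
    moreover have "a \<in> \<Inter> S"
      using AB \<open>A = {a}\<close> by (auto simp: complete_bipartite_def)
    ultimately show "card S = u \<and> \<Inter> S \<noteq> {}" by blast
  next
    assume S: "card S = u \<and> \<Inter> S \<noteq> {}"
    then obtain a where a: "\<And>e. e \<in> S \<Longrightarrow> a \<in> e" by auto
    define B where "B = {b. {a, b} \<in> S}"
    \<comment> \<open>If \<open>a\<close> were a leaf, \<open>{a, a}\<close> would be an edge with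
      only one element.\<close>
    have "a \<notin> B" using edges by (force simp: B_def)
    have "S = complete_bipartite {a} B"
    proof (intro equalityI subsetI)
      fix e assume e: "e \<in> S"
      with edges obtain x y where "e = {x, y}" by (meson card_2_iff)
      with a[OF e] have "e = {a, x} \<or> e = {a, y}" by auto
      with e show "e \<in> complete_bipartite {a} B"
        by (auto simp: complete_bipartite_def B_def)
    qed (auto simp: complete_bipartite_def B_def)
    with S card_star[OF \<open>a \<notin> B\<close>] \<open>a \<notin> B\<close> show "is_claw u S"
      unfolding is_claw_def by (intro exI[of _ "{a}"] exI[of _ B]) simp
  qed
qed

lemma is_path_2_iff: "is_path 2 E \<longleftrightarrow> (\<exists>a b c. distinct [a, b, c] \<and> E = {{a, b}, {b, c}})"
proof -
  have eq: "{{vs ! i, vs ! (i + 1)} | i. i < 2} = {{a, b}, {b, c}}" if "vs = [a, b, c]" for vs and a b c :: 'a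
  proof -
    have "{{vs ! i, vs ! (i + 1)} | i. i < 2} = (\<lambda>i. {vs ! i, vs ! (i + 1)}) ` {..<2}" by auto
    with that show ?thesis by (simp add: numeral_2_eq_2 lessThan_Suc insert_commute)
  qed
  show ?thesis
  proof
    assume "is_path 2 E"
    then obtain vs where vs: "distinct vs" "length vs = 3" "E = {{vs ! i, vs ! (i + 1)} | i. i < 2}"
      by (auto simp: is_path_def)
    then obtain a b c where "vs = [a, b, c]"
      by (auto simp: numeral_3_eq_3 length_Suc_conv)
    with vs(1) vs(3)[unfolded eq[OF this]]
    show "\<exists>a b c. distinct [a, b, c] \<and> E = {{a, b}, {b, c}}"
      by (intro exI[of _ a] exI[of _ b] exI[of _ c]) simp
  next
    assume "\<exists>a b c. distinct [a, b, c] \<and> E = {{a, b}, {b, c}}"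
    then obtain a b c where "distinct [a, b, c]" "E = {{a, b}, {b, c}}" by blast
    with eq[of "[a, b, c]"] show "is_path 2 E"
      unfolding is_path_def by (intro exI[of _ "[a, b, c]"]) simp
  qed
qed

lemma is_path_3_iff:
  "is_path 3 E \<longleftrightarrow> (\<exists>a b c d. distinct [a, b, c, d] \<and> E = {{a, b}, {b, c}, {c, d}})"
proof -
  have eq: "{{vs ! i, vs ! (i + 1)} | i. i < 3} = {{a, b}, {b, c}, {c, d}}"
    if "vs = [a, b, c, d]" for vs and a b c d :: 'a
  proof -
    have "{{vs ! i, vs ! (i + 1)} | i. i < 3} = (\<lambda>i. {vs ! i, vs ! (i + 1)}) ` {..<3}" by auto
    with that show ?thesis by (simp add: numeral_3_eq_3 lessThan_Suc insert_commute)
  qed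
  show ?thesis
  proof
    assume "is_path 3 E"
    then obtain vs where vs: "distinct vs" "length vs = 4" "E = {{vs ! i, vs ! (i + 1)} | i. i < 3}"
      by (auto simp: is_path_def)
    then obtain a b c d where "vs = [a, b, c, d]"
      by (auto simp: numeral_eq_Suc length_Suc_conv)
    with vs(1) vs(3)[unfolded eq[OF this]]
    show "\<exists>a b c d. distinct [a, b, c, d] \<and> E = {{a, b}, {b, c}, {c, d}}"
      by (intro exI[of _ a] exI[of _ b] exI[of _ c] exI[of _ d]) simp
  next
    assume "\<exists>a b c d. distinct [a, b, c, d] \<and> E = {{a, b}, {b, c}, {c, d}}"
    then obtain a b c d where "distinct [a, b, c, d]" "E = {{a, b}, {b, c}, {c, d}}" by blast
    with eq[of "[a, b, c, d]"] show "is_path 3 E"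
      unfolding is_path_def by (intro exI[of _ "[a, b, c, d]"]) simp
  qed
qed

text \<open>The middle vertex of the path is the centre of the claw. Hence 2-paths, too, are
  governed by \<open>is_claw_iff\<close>.\<close>

lemma is_path_2_iff_claw: "is_path 2 E \<longleftrightarrow> is_claw 2 E"
proof
  assume "is_path 2 E"
  then obtain a b c where abc: "distinct [a, b, c]" "E = {{a, b}, {b, c}}"
    unfolding is_path_2_iff by blast
  then have "E = complete_bipartite {b} {a, c}"
    by (auto simp: complete_bipartite_def)
  with abc show "is_claw 2 E"
    unfolding is_claw_def by (intro exI[of _ "{b}"] exI[of _ "{a, c}"]) auto
next
  assume "is_claw 2 E"
  then obtain A B where AB: "A \<inter> B = {}" "card A = 1" "card B = 2" "E = complete_bipartite A B"
    by (auto simp: is_claw_def)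
  from AB obtain b where "A = {b}" by (meson card_1_singletonE)
  moreover from AB obtain a c where "B = {a, c}" "a \<noteq> c" by (meson card_2_iff)
  ultimately have "distinct [a, b, c]" "E = {{a, b}, {b, c}}"
    using AB by (auto simp: complete_bipartite_def)
  then show "is_path 2 E" unfolding is_path_2_iff by blast
qed

lemma num_paths_2: "num_paths 2 \<Gamma> = num_claws 2 \<Gamma>"
  by (simp add: num_paths_def num_claws_def is_path_2_iff_claw)

lemma card_edge: "e \<in> K_graph m \<Longrightarrow> card e = 2"
  by (auto simp: mem_K_graph)

text \<open>Claws are sorted by their centre. A star with at least two edges has only one centre, so
  the families are disjoint; for \<open>u = 1\<close> each edge would be counted at both
  ends.\<close>

lemma num_claws_eq_sum:
  assumes "\<Gamma> \<subseteq> K_graph m" "2 \<le> u"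
  shows "num_claws u \<Gamma> = (\<Sum>i=1..m. vertex_degree \<Gamma> (Row i) choose u)
    + (\<Sum>j=1..m. vertex_degree \<Gamma> (Col j) choose u)"
proof -
  let ?V = "rows m \<union> cols m"
  let ?S = "\<lambda>v. {S. S \<subseteq> {e \<in> \<Gamma>. v \<in> e} \<and> card S = u}"
  have fin: "finite \<Gamma>" using assms(1) by (rule finite_subset) simp
  have edges: "card e = 2" if "e \<in> \<Gamma>" for e using that assms(1) card_edge by blast
  have claw: "is_claw u S \<longleftrightarrow> card S = u \<and> \<Inter> S \<noteq> {}" if "S \<subseteq> \<Gamma>" for S
    using that edges assms(2) by (intro is_claw_iff) auto
  have "{S. S \<subseteq> \<Gamma> \<and> is_claw u S} = (\<Union>v\<in>?V. ?S v)"
  proof (intro equalityI subsetI)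
    fix S assume "S \<in> {S. S \<subseteq> \<Gamma> \<and> is_claw u S}"
    then have S: "S \<subseteq> \<Gamma>" "card S = u" "\<Inter> S \<noteq> {}" using claw by auto
    then obtain v where v: "\<And>e. e \<in> S \<Longrightarrow> v \<in> e" by auto
    from S assms(2) obtain e where e: "e \<in> S" by fastforce
    then have "e \<in> K_graph m" using S assms(1) by auto
    with v[OF e] have "v \<in> ?V" by (auto simp: mem_K_graph)
    moreover have "S \<in> ?S v" using S v by auto
    ultimately show "S \<in> (\<Union>v\<in>?V. ?S v)" by (rule UN_I)
  next
    fix S assume "S \<in> (\<Union>v\<in>?V. ?S v)"
    then obtain v where S: "S \<subseteq> {e \<in> \<Gamma>. v \<in> e}" "card S = u" by blast
    then have "v \<in> \<Inter> S" "S \<subseteq> \<Gamma>" by auto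
    with S claw show "S \<in> {S. S \<subseteq> \<Gamma> \<and> is_claw u S}" by auto
  qed
  moreover have "card (\<Union>v\<in>?V. ?S v) = (\<Sum>v\<in>?V. card (?S v))"
  proof (rule card_UN_disjoint)
    show "\<forall>v\<in>?V. \<forall>w\<in>?V. v \<noteq> w \<longrightarrow> ?S v \<inter> ?S w = {}"
    proof (intro ballI impI)
      fix v w :: vertex assume "v \<noteq> w"
      have False if S: "S \<subseteq> {e \<in> \<Gamma>. v \<in> e}" "S \<subseteq> {e \<in> \<Gamma>. w \<in> e}" "card S = u" for S
      proof -
        \<comment> \<open>Two distinct common vertices exhaust every edge of \<open>S\<close>, which
          leaves room for at most one edge.\<close>
        have "S \<subseteq> {{v, w}}"
        proof
          fix e assume "e \<in> S"
          then have "v \<in> e" "w \<in> e" "card e = 2" using S edges by auto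
          with \<open>v \<noteq> w\<close> show "e \<in> {{v, w}}" by (auto simp: card_2_iff)
        qed
        then have "card S \<le> card {{v, w}}" by (intro card_mono) auto
        with S assms(2) show False by simp
      qed
      then show "?S v \<inter> ?S w = {}" by auto
    qed
  qed (use fin in auto)
  moreover have "card (?S v) = vertex_degree \<Gamma> v choose u" for v
    unfolding vertex_degree_def using fin by (intro n_subsets) simp
  moreover have "(\<Sum>v\<in>?V. f v) = (\<Sum>i=1..m. f (Row i)) + (\<Sum>j=1..m. f (Col j))" for f :: "vertex \<Rightarrow> nat"
  proof -
    have "(\<Sum>v\<in>?V. f v) = sum f (rows m) + sum f (cols m)"
      by (rule sum.union_disjoint) simp_all
    then show ?thesis by (simp add: rows_def cols_def sum.reindex inj_on_def)
  qed
  ultimately show ?thesis by (simp add: num_claws_def)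
qed

text \<open>Two distinct edges form a 2-path exactly when they meet, so the colour of a triple is
  its number of meeting pairs.\<close>

lemma num_claws_2_triple:
  assumes edges: "card e1 = 2" "card e2 = 2" "card e3 = 2" and ne: "e1 \<noteq> e2" "e1 \<noteq> e3" "e2 \<noteq> e3"
  shows "num_claws 2 {e1, e2, e3} =
    of_bool (e1 \<inter> e2 \<noteq> {}) + of_bool (e1 \<inter> e3 \<noteq> {}) + of_bool (e2 \<inter> e3 \<noteq> {})"
proof -
  let ?A = "{{e1, e2}, {e1, e3}, {e2, e3}}"
  have claw: "is_claw 2 S \<longleftrightarrow> card S = 2 \<and> \<Inter> S \<noteq> {}" if "S \<subseteq> {e1, e2, e3}" for S
    using that edges by (intro is_claw_iff) auto
  have two: "S \<subseteq> {e1, e2, e3} \<and> card S = 2 \<longleftrightarrow> S \<in> ?A" for S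
  proof
    assume "S \<subseteq> {e1, e2, e3} \<and> card S = 2"
    then obtain x y where xy: "S = {x, y}" "x \<noteq> y" "x \<in> {e1, e2, e3}" "y \<in> {e1, e2, e3}"
      by (auto simp: card_2_iff)
    from xy(3,4) xy(2) show "S \<in> ?A"
      unfolding insert_iff empty_iff xy(1) by (elim disjE) (simp_all add: insert_commute)
  next
    assume "S \<in> ?A"
    then consider "S = {e1, e2}" | "S = {e1, e3}" | "S = {e2, e3}" unfolding insert_iff empty_iff by argo
    then show "S \<subseteq> {e1, e2, e3} \<and> card S = 2" by cases (simp_all add: ne)
  qed
  have "S \<subseteq> {e1, e2, e3} \<and> is_claw 2 S \<longleftrightarrow> S \<in> ?A \<and> \<Inter> S \<noteq> {}" for S
    unfolding two[symmetric] using claw[of S] by argo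
  then have "{S. S \<subseteq> {e1, e2, e3} \<and> is_claw 2 S} = ?A \<inter> {S. \<Inter> S \<noteq> {}}"
    unfolding Collect_conj_eq[symmetric] Int_def by (simp only: mem_Collect_eq)
  then have "num_claws 2 {e1, e2, e3} = (\<Sum>S\<in>?A. of_bool (\<Inter> S \<noteq> {}))"
    by (simp add: num_claws_def sum_of_bool_eq)
  also have "\<dots> = of_bool (e1 \<inter> e2 \<noteq> {}) + of_bool (e1 \<inter> e3 \<noteq> {}) + of_bool (e2 \<inter> e3 \<noteq> {})"
    using ne by (simp add: doubleton_eq_iff)
  finally show ?thesis .
qed

lemma num_claws_2_pair:
  assumes edges: "card e1 = 2" "card e2 = 2" and ne: "e1 \<noteq> e2"
  shows "num_claws 2 {e1, e2} = of_bool (e1 \<inter> e2 \<noteq> {})"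
proof -
  have claw: "is_claw 2 S \<longleftrightarrow> card S = 2 \<and> \<Inter> S \<noteq> {}" if "S \<subseteq> {e1, e2}" for S
    using that edges by (intro is_claw_iff) auto
  have two: "S = {e1, e2}" if "S \<subseteq> {e1, e2}" "card S = 2" for S
    using that ne by (intro card_subset_eq) auto
  have "S \<subseteq> {e1, e2} \<and> is_claw 2 S \<longleftrightarrow> S = {e1, e2} \<and> e1 \<inter> e2 \<noteq> {}" for S
  proof
    assume S: "S \<subseteq> {e1, e2} \<and> is_claw 2 S"
    then have "card S = 2" "\<Inter> S \<noteq> {}" using claw[of S] by simp_all
    moreover from this have "S = {e1, e2}" using S two by simp
    ultimately show "S = {e1, e2} \<and> e1 \<inter> e2 \<noteq> {}" by simp
  next
    assume "S = {e1, e2} \<and> e1 \<inter> e2 \<noteq> {}"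
    with claw[of S] ne show "S \<subseteq> {e1, e2} \<and> is_claw 2 S" by simp
  qed
  then have "{S. S \<subseteq> {e1, e2} \<and> is_claw 2 S} = (if e1 \<inter> e2 \<noteq> {} then {{e1, e2}} else {})"
    by simp
  then show ?thesis unfolding num_claws_def by simp
qed

section \<open>Invariance of claws and paths\<close>

lemma is_claw_graph_act:
  assumes "inj g" "is_claw u S"
  shows "is_claw u (graph_act g S)"
proof -
  obtain A B where AB: "A \<inter> B = {}" "card A = 1" "card B = u" "S = complete_bipartite A B"
    using assms(2) by (auto simp: is_claw_def)
  have "graph_act g S = complete_bipartite (g ` A) (g ` B)"
  proof -
    have cb: "e \<in> complete_bipartite A B \<longleftrightarrow> (\<exists>a\<in>A. \<exists>b\<in>B. e = {a, b})" for A B :: "vertex set" and e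
      unfolding complete_bipartite_def by auto
    show ?thesis
    proof (intro equalityI subsetI)
      fix e assume "e \<in> graph_act g S"
      then obtain e' where "e' \<in> S" "e = g ` e'" unfolding graph_act_def by blast
      then obtain a b where "a \<in> A" "b \<in> B" "e = {g a, g b}" unfolding AB cb by force
      then show "e \<in> complete_bipartite (g ` A) (g ` B)" unfolding cb by blast
    next
      fix e assume "e \<in> complete_bipartite (g ` A) (g ` B)"
      then obtain a b where ab: "a \<in> A" "b \<in> B" "e = {g a, g b}" unfolding cb by blast
      then have "{a, b} \<in> S" unfolding AB cb by blast
      moreover have "e = g ` {a, b}" using ab by simp
      ultimately show "e \<in> graph_act g S" unfolding graph_act_def by blast
    qed
  qed
  moreover have "g ` A \<inter> g ` B = {}" using AB assms(1) by (simp add: image_Int[symmetric])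
  moreover have "card (g ` A) = 1" "card (g ` B) = u"
    using AB assms(1) by (simp_all add: card_image inj_on_subset)
  ultimately show ?thesis unfolding is_claw_def by blast
qed

lemma num_claws_graph_act:
  assumes "bij g"
  shows "num_claws u (graph_act g \<Gamma>) = num_claws u \<Gamma>"
proof -
  \<comment> \<open>The reverse implication is the forward one applied to the inverse of
    \<open>g\<close>.\<close>
  have claw: "is_claw u (graph_act g S) \<longleftrightarrow> is_claw u S" for S
    using is_claw_graph_act[OF bij_is_inj[OF assms], of u S]
      is_claw_graph_act[OF bij_is_inj[OF bij_imp_bij_inv[OF assms]], of u "graph_act g S"]
    by (auto simp: graph_act_inv[OF assms])
  have "{S. S \<subseteq> graph_act g \<Gamma> \<and> is_claw u S} = graph_act g ` {S. S \<subseteq> \<Gamma> \<and> is_claw u S}"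
  proof (intro equalityI subsetI)
    fix S assume S: "S \<in> {S. S \<subseteq> graph_act g \<Gamma> \<and> is_claw u S}"
    define S' where "S' = graph_act (inv_into UNIV g) S"
    have "S = graph_act g S'" by (simp add: S'_def graph_act_inv[OF assms])
    with S show "S \<in> graph_act g ` {S. S \<subseteq> \<Gamma> \<and> is_claw u S}"
      by (simp add: graph_act_mono_iff[OF assms] claw)
  next
    fix S assume "S \<in> graph_act g ` {S. S \<subseteq> \<Gamma> \<and> is_claw u S}"
    then obtain S' where "S = graph_act g S'" "S' \<subseteq> \<Gamma>" "is_claw u S'" by blast
    then show "S \<in> {S. S \<subseteq> graph_act g \<Gamma> \<and> is_claw u S}"
      by (simp add: graph_act_mono_iff[OF assms] claw)
  qed
  then show ?thesis
    unfolding num_claws_def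
    by (simp add: card_image inj_on_subset[OF inj_graph_act[OF assms]])
qed

lemma is_path_3_graph_act:
  assumes "inj g" "is_path 3 S"
  shows "is_path 3 (graph_act g S)"
proof -
  obtain a b c d where S: "distinct [a, b, c, d]" "S = {{a, b}, {b, c}, {c, d}}"
    using assms(2) unfolding is_path_3_iff by blast
  then have "distinct [g a, g b, g c, g d]" using assms(1) by (auto dest: injD)
  moreover have "graph_act g S = {{g a, g b}, {g b, g c}, {g c, g d}}"
    using S by (simp add: graph_act_def)
  ultimately show ?thesis
    unfolding is_path_3_iff by (intro exI[of _ "g a"] exI[of _ "g b"] exI[of _ "g c"] exI[of _ "g d"] conjI)
qed

subsection \<open>Orbits on pairs and triples of edges\<close>

definition edge :: "nat \<Rightarrow> nat \<Rightarrow> vertex set"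
  where "edge i j = {Row i, Col j}"

lemma edge_eq_iff [simp]: "edge a b = edge c d \<longleftrightarrow> a = c \<and> b = d"
  by (auto simp: edge_def doubleton_eq_iff)

lemma edge_meet_iff [simp]: "edge a b \<inter> edge c d = {} \<longleftrightarrow> a \<noteq> c \<and> b \<noteq> d"
  by (auto simp: edge_def)

lemma card_edge_2 [simp]: "card (edge a b) = 2"
  by (simp add: edge_def)

lemma edge_in_K_graph [simp]: "edge a b \<in> K_graph m \<longleftrightarrow> a \<in> {1..m} \<and> b \<in> {1..m}"
  by (auto simp: edge_def mem_K_graph doubleton_eq_iff)

lemma K_graph_edgeE:
  assumes "e \<in> K_graph m"
  obtains i j where "e = edge i j" "i \<in> {1..m}" "j \<in> {1..m}"
  using assms by (auto simp: mem_K_graph edge_def)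

text \<open>The prescribed values on an initial segment are completed by any bijection between the
  two complements, which have equal size.\<close>

lemma ex_permutes_list:
  assumes "distinct as" "set as \<subseteq> {1..m}"
  shows "\<exists>p. p permutes {1..m} \<and> (\<forall>i<length as. p (Suc i) = as ! i)"
proof -
  let ?n = "length as"
  have card: "card (set as) = ?n" using assms(1) by (rule distinct_card)
  have n: "?n \<le> m" using card_mono[OF _ assms(2)] card by simp
  have "card {Suc ?n..m} = card ({1..m} - set as)"
    using card assms(2) by (simp add: card_Diff_subset)
  then obtain h where h: "bij_betw h {Suc ?n..m} ({1..m} - set as)"
    using finite_same_card_bij[of "{Suc ?n..m}" "{1..m} - set as"] by auto
  \<comment> \<open>Vertices are numbered from 1 and list positions from 0, hence the shift in
    \<open>as ! (i - 1)\<close>.\<close>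
  define p where "p i = (if i \<in> {1..?n} then as ! (i - 1) else if i \<in> {Suc ?n..m} then h i else i)" for i
  have "bij_betw (\<lambda>i. i - 1) {1..?n} {..<?n}"
    by (rule bij_betw_byWitness[where f' = Suc]) auto
  from bij_betw_trans[OF this bij_betw_nth[OF assms(1) refl refl]]
  have "bij_betw p {1..?n} (set as)"
    by (rule bij_betw_cong[THEN iffD1, rotated]) (simp add: p_def)
  moreover have "bij_betw p {Suc ?n..m} ({1..m} - set as)"
    using h by (rule bij_betw_cong[THEN iffD1, rotated]) (simp add: p_def)
  ultimately have "bij_betw p ({1..?n} \<union> {Suc ?n..m}) (set as \<union> ({1..m} - set as))"
    by (rule bij_betw_combine) auto
  moreover have "{1..?n} \<union> {Suc ?n..m} = {1..m}" using n by auto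
  moreover have "set as \<union> ({1..m} - set as) = {1..m}" using assms(2) by auto
  ultimately have "p permutes {1..m}"
    using n by (intro bij_imp_permutes) (auto simp: p_def)
  then show ?thesis by (intro exI[of _ p]) (simp add: p_def)
qed

text \<open>Row and column indices can be permuted independently of each other; the witness maps
  each part to itself.\<close>

lemma ex_part_aut:
  assumes p: "p permutes {1..m}" and q: "q permutes {1..m}"
  shows "\<exists>g\<in>part_auts m. \<forall>i j. g ` edge i j = edge (p i) (q j)"
proof -
  define g where "g v = (case v of Row i \<Rightarrow> Row (p i) | Col j \<Rightarrow> Col (q j))" for v
  have g: "g (Row i) = Row (p i)" "g (Col i) = Col (q i)" for i by (simp_all add: g_def)
  have "\<exists>!v. g v = w" for w
  proof (cases w)
    case (Row i)
    obtain x where x: "p x = i" "\<And>y. p y = i \<Longrightarrow> y = x"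
      using permutes_inverses(1)[OF p, of i] permutes_inverses(2)[OF p] by metis
    show ?thesis
    proof (rule ex1I[of _ "Row x"])
      show "v = Row x" if "g v = w" for v using that x(2) Row by (cases v) (simp_all add: g)
    qed (use x(1) Row in \<open>simp add: g\<close>)
  next
    case (Col i)
    obtain x where x: "q x = i" "\<And>y. q y = i \<Longrightarrow> y = x"
      using permutes_inverses(1)[OF q, of i] permutes_inverses(2)[OF q] by metis
    show ?thesis
    proof (rule ex1I[of _ "Col x"])
      show "v = Col x" if "g v = w" for v using that x(2) Col by (cases v) (simp_all add: g)
    qed (use x(1) Col in \<open>simp add: g\<close>)
  qed
  moreover have "g v = v" if "v \<notin> rows m \<union> cols m" for v
    using that permutes_not_in[OF p] permutes_not_in[OF q] by (cases v) (auto simp: g)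
  ultimately have "g permutes rows m \<union> cols m" unfolding permutes_def by blast
  moreover have "g ` rows m = rows m"
  proof -
    have "g ` rows m = Row ` p ` {1..m}" by (simp add: rows_def image_image g)
    then show ?thesis unfolding permutes_image[OF p] rows_def .
  qed
  ultimately have "g \<in> part_auts m" unfolding part_auts_def by simp
  then show ?thesis by (intro bexI[of _ g]) (simp_all add: edge_def g)
qed

lemma ex_part_aut_list:
  assumes "distinct as" "set as \<subseteq> {1..m}" "distinct bs" "set bs \<subseteq> {1..m}"
  shows "\<exists>g\<in>part_auts m. \<forall>i<length as. \<forall>j<length bs. g ` edge (Suc i) (Suc j) = edge (as ! i) (bs ! j)"
proof -
  obtain p q where p: "p permutes {1..m}" "\<forall>i<length as. p (Suc i) = as ! i"
    and q: "q permutes {1..m}" "\<forall>i<length bs. q (Suc i) = bs ! i"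
    using ex_permutes_list[OF assms(1,2)] ex_permutes_list[OF assms(3,4)] by blast
  obtain g where "g \<in> part_auts m" "\<forall>i j. g ` edge i j = edge (p i) (q j)"
    using ex_part_aut[OF p(1) q(1)] by blast
  with p(2) q(2) show ?thesis by (intro bexI[of _ g]) simp_all
qed

lemma graph_orbitI: "g \<in> part_auts m \<Longrightarrow> graph_act g \<Gamma> = \<Delta> \<Longrightarrow> \<Delta> \<in> graph_orbit m \<Gamma>"
  unfolding graph_orbit_def by (intro CollectI exI[of _ g] conjI) simp_all

lemma graph_orbit_act:
  assumes "g \<in> part_auts m" "\<Delta> \<in> graph_orbit m \<Gamma>"
  shows "graph_act g \<Delta> \<in> graph_orbit m \<Gamma>"
proof -
  obtain h where "h \<in> part_auts m" "\<Delta> = graph_act h \<Gamma>"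
    using assms(2) unfolding graph_orbit_def by auto
  then show ?thesis
    by (intro graph_orbitI[of "g \<circ> h"] part_auts_comp assms(1)) (simp_all add: graph_act_comp)
qed

text \<open>If \<open>g\<close> and \<open>h\<close> carry the representative to \<open>S\<close>
  and \<open>T\<close>, then \<open>h\<close> after the inverse of \<open>g\<close> carries
  \<open>S\<close> to \<open>T\<close>.\<close>

lemma graph_orbit_connects:
  assumes "S \<in> graph_orbit m \<Gamma>" "T \<in> graph_orbit m \<Gamma>"
  shows "\<exists>g\<in>part_auts m. T = graph_act g S"
proof -
  obtain g h where g: "g \<in> part_auts m" "S = graph_act g \<Gamma>" and h: "h \<in> part_auts m" "T = graph_act h \<Gamma>"
    using assms unfolding graph_orbit_def by auto
  have "T = graph_act (h \<circ> inv_into UNIV g) S"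
    unfolding graph_act_comp g(2) h(2) by (simp add: graph_act_inv bij_part_auts[OF g(1)])
  then show ?thesis using part_auts_comp[OF h(1) part_auts_inv[OF g(1)]] by blast
qed

lemma num_claws_graph_orbit:
  "T \<in> graph_orbit m \<Gamma> \<Longrightarrow> num_claws u T = num_claws u \<Gamma>"
  by (auto simp: graph_orbit_def num_claws_graph_act bij_part_auts)

lemma tau_edge:
  assumes "edge i j \<in> K_graph m"
  shows "tau m ` edge i j = edge j i"
  using assms[unfolded edge_in_K_graph] by (simp add: edge_def insert_commute)

text \<open>Interchanging the parts transposes all index pairs. This reduces a coincidence of
  columns to a coincidence of rows and halves the case analysis.\<close>

lemma transpose_triple:
  assumes "{edge b a, edge d c, edge f e} \<in> graph_orbit m \<Gamma>"
    and "{edge a b, edge c d, edge e f} \<subseteq> K_graph m"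
  shows "{edge a b, edge c d, edge e f} \<in> graph_orbit m \<Gamma>"
proof -
  have "graph_act (tau m) {edge b a, edge d c, edge f e} = {edge a b, edge c d, edge e f}"
    using assms(2) by (simp add: graph_act_def tau_edge)
  with graph_orbit_act[OF tau_in_part_auts assms(1)] show ?thesis by simp
qed

lemma transpose_pair:
  assumes "{edge b a, edge d c} \<in> graph_orbit m \<Gamma>" and "{edge a b, edge c d} \<subseteq> K_graph m"
  shows "{edge a b, edge c d} \<in> graph_orbit m \<Gamma>"
proof -
  have "graph_act (tau m) {edge b a, edge d c} = {edge a b, edge c d}"
    using assms(2) by (simp add: graph_act_def tau_edge)
  with graph_orbit_act[OF tau_in_part_auts assms(1)] show ?thesis by simp
qed

text \<open>Representatives of the four types of triples. Stars and mixed triples can be centred at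
  a row or at a column; the row form is chosen and \<open>tau m\<close> supplies the other. In
  \<open>std_path\<close> the middle edge is \<open>edge 1 1\<close>.\<close>

definition "std_star = {edge 1 1, edge 1 2, edge 1 3}"
definition "std_path = {edge 1 1, edge 1 2, edge 2 1}"
definition "std_mixed = {edge 1 1, edge 1 2, edge 2 3}"
definition "std_matching = {edge 1 1, edge 2 2, edge 3 3}"

lemmas std_triple_defs = std_star_def std_path_def std_mixed_def std_matching_def

lemma std_colours:
  "num_claws 2 std_star = 3" "num_claws 2 std_path = 2"
  "num_claws 2 std_mixed = 1" "num_claws 2 std_matching = 0"
  by (simp_all add: std_triple_defs num_claws_2_triple)

text \<open>Only the pattern of equal and distinct indices matters: an automorphism takes the
  indices of the standard triple to the prescribed ones. The same argument serves the other
  types.\<close>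

lemma in_orbit_star:
  assumes "a \<in> {1..m}" "{b, c, d} \<subseteq> {1..m}" "distinct [b, c, d]"
  shows "{edge a b, edge a c, edge a d} \<in> graph_orbit m std_star"
proof -
  obtain g where g: "g \<in> part_auts m"
    "\<forall>i<length [a]. \<forall>j<length [b, c, d]. g ` edge (Suc i) (Suc j) = edge ([a] ! i) ([b, c, d] ! j)"
    using ex_part_aut_list[of "[a]" m "[b, c, d]"] assms by auto
  have "graph_act g std_star = {edge a b, edge a c, edge a d}"
    using g(2)[rule_format, of 0 0] g(2)[rule_format, of 0 1] g(2)[rule_format, of 0 2]
    by (simp add: graph_act_def std_star_def numeral_2_eq_2 numeral_3_eq_3)
  with g(1) show ?thesis by (rule graph_orbitI)
qed

lemma in_orbit_path:
  assumes "{a, d} \<subseteq> {1..m}" "{b, c} \<subseteq> {1..m}" "a \<noteq> d" "b \<noteq> c"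
  shows "{edge a b, edge a c, edge d b} \<in> graph_orbit m std_path"
proof -
  obtain g where g: "g \<in> part_auts m"
    "\<forall>i<length [a, d]. \<forall>j<length [b, c]. g ` edge (Suc i) (Suc j) = edge ([a, d] ! i) ([b, c] ! j)"
    using ex_part_aut_list[of "[a, d]" m "[b, c]"] assms by auto
  have "graph_act g std_path = {edge a b, edge a c, edge d b}"
    using g(2)[rule_format, of 0 0] g(2)[rule_format, of 0 1] g(2)[rule_format, of 1 0]
    by (simp add: graph_act_def std_path_def numeral_2_eq_2)
  with g(1) show ?thesis by (rule graph_orbitI)
qed

lemma in_orbit_mixed:
  assumes "{a, e} \<subseteq> {1..m}" "{b, c, d} \<subseteq> {1..m}" "a \<noteq> e" "distinct [b, c, d]"
  shows "{edge a b, edge a c, edge e d} \<in> graph_orbit m std_mixed"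
proof -
  obtain g where g: "g \<in> part_auts m"
    "\<forall>i<length [a, e]. \<forall>j<length [b, c, d]. g ` edge (Suc i) (Suc j) = edge ([a, e] ! i) ([b, c, d] ! j)"
    using ex_part_aut_list[of "[a, e]" m "[b, c, d]"] assms by auto
  have "graph_act g std_mixed = {edge a b, edge a c, edge e d}"
    using g(2)[rule_format, of 0 0] g(2)[rule_format, of 0 1] g(2)[rule_format, of 1 2]
    by (simp add: graph_act_def std_mixed_def numeral_2_eq_2 numeral_3_eq_3)
  with g(1) show ?thesis by (rule graph_orbitI)
qed

lemma in_orbit_matching:
  assumes "{a, c, e} \<subseteq> {1..m}" "{b, d, f} \<subseteq> {1..m}" "distinct [a, c, e]" "distinct [b, d, f]"
  shows "{edge a b, edge c d, edge e f} \<in> graph_orbit m std_matching"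
proof -
  obtain g where g: "g \<in> part_auts m"
    "\<forall>i<length [a, c, e]. \<forall>j<length [b, d, f].
      g ` edge (Suc i) (Suc j) = edge ([a, c, e] ! i) ([b, d, f] ! j)"
    using ex_part_aut_list[of "[a, c, e]" m "[b, d, f]"] assms by auto
  have "graph_act g std_matching = {edge a b, edge c d, edge e f}"
    using g(2)[rule_format, of 0 0] g(2)[rule_format, of 1 1] g(2)[rule_format, of 2 2]
    by (simp add: graph_act_def std_matching_def numeral_2_eq_2 numeral_3_eq_3)
  with g(1) show ?thesis by (rule graph_orbitI)
qed

definition "std_triple_orbits m = \<Union> (graph_orbit m ` {std_star, std_path, std_mixed, std_matching})"

lemma std_triple_orbitsI:
  "T \<in> graph_orbit m std_star \<Longrightarrow> T \<in> std_triple_orbits m"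
  "T \<in> graph_orbit m std_path \<Longrightarrow> T \<in> std_triple_orbits m"
  "T \<in> graph_orbit m std_mixed \<Longrightarrow> T \<in> std_triple_orbits m"
  "T \<in> graph_orbit m std_matching \<Longrightarrow> T \<in> std_triple_orbits m"
  by (simp_all add: std_triple_orbits_def)

lemma std_triple_orbits_transpose:
  assumes "{edge b a, edge d c, edge f e} \<in> std_triple_orbits m"
    and "{edge a b, edge c d, edge e f} \<subseteq> K_graph m"
  shows "{edge a b, edge c d, edge e f} \<in> std_triple_orbits m"
  using assms(1) transpose_triple[OF _ assms(2)] unfolding std_triple_orbits_def by blast

text \<open>Two edges meet at row \<open>a\<close>, and the third lies at another row, so its column
  decides: shared with one of the two it gives a path, otherwise a 2-path with a disjoint
  edge.\<close>

lemma std_triple_orbits_two_equal_rows: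
  assumes "{edge a b, edge a c, edge e d} \<subseteq> K_graph m" "a \<noteq> e" "b \<noteq> c"
  shows "{edge a b, edge a c, edge e d} \<in> std_triple_orbits m"
proof -
  consider "d = b" | "d = c" | "distinct [b, c, d]" using assms by auto
  then show ?thesis
  proof cases
    case 1
    with in_orbit_path[of a e m b c] assms show ?thesis by (auto intro: std_triple_orbitsI)
  next
    case 2
    with in_orbit_path[of a e m c b] assms have "{edge a c, edge a b, edge e c} \<in> std_triple_orbits m"
      by (auto intro: std_triple_orbitsI)
    with 2 show ?thesis by (simp add: insert_commute)
  next
    case 3
    with in_orbit_mixed[of a e m b c d] assms show ?thesis by (auto intro: std_triple_orbitsI)
  qed
qed

text \<open>Up to reordering the edges, either all three rows agree, which is a star, or exactly two
  agree.\<close>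

lemma std_triple_orbits_equal_rows:
  assumes K: "{edge a b, edge c d, edge e f} \<subseteq> K_graph m"
    and ne: "edge a b \<noteq> edge c d" "edge a b \<noteq> edge e f" "edge c d \<noteq> edge e f"
    and eq: "\<not> distinct [a, c, e]"
  shows "{edge a b, edge c d, edge e f} \<in> std_triple_orbits m"
proof -
  consider "a = c" "a = e" | "a = c" "a \<noteq> e" | "a = e" "a \<noteq> c" | "c = e" "a \<noteq> c" using eq by auto
  then show ?thesis
  proof cases
    case 1
    then show ?thesis using in_orbit_star[of a m b d f] K ne by (auto intro: std_triple_orbitsI)
  next
    case 2
    then show ?thesis using std_triple_orbits_two_equal_rows[of a b d e f m] K ne by auto
  next
    case 3
    then have "{edge a b, edge e f, edge c d} \<in> std_triple_orbits m"
      using std_triple_orbits_two_equal_rows[of a b f c d m] K ne by auto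
    then show ?thesis by (simp add: insert_commute)
  next
    case 4
    then have "{edge c d, edge e f, edge a b} \<in> std_triple_orbits m"
      using std_triple_orbits_two_equal_rows[of c d f a b m] K ne by auto
    then show ?thesis by (simp add: insert_commute)
  qed
qed

text \<open>A repeated row is handled directly and a repeated column by transposition; with neither,
  the edges are pairwise disjoint.\<close>

lemma triple_in_std_orbit:
  assumes "T \<subseteq> K_graph m" "card T = 3"
  shows "T \<in> std_triple_orbits m"
proof -
  obtain e1 e2 e3 where T: "T = {e1, e2, e3}" and ne: "e1 \<noteq> e2" "e1 \<noteq> e3" "e2 \<noteq> e3"
    using assms(2) by (auto simp: card_3_iff)
  obtain a b where e1: "e1 = edge a b" using assms(1) T by (auto elim: K_graph_edgeE)
  obtain c d where e2: "e2 = edge c d" using assms(1) T by (auto elim: K_graph_edgeE)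
  obtain e f where e3: "e3 = edge e f" using assms(1) T by (auto elim: K_graph_edgeE)
  note K = assms(1)[unfolded T e1 e2 e3] and ne = ne[unfolded e1 e2 e3]
  consider "\<not> distinct [a, c, e]" | "\<not> distinct [b, d, f]" | "distinct [a, c, e]" "distinct [b, d, f]"
    by blast
  then have "{edge a b, edge c d, edge e f} \<in> std_triple_orbits m"
  proof cases
    case 1
    with K ne show ?thesis by (intro std_triple_orbits_equal_rows)
  next
    case 2
    then have "{edge b a, edge d c, edge f e} \<in> std_triple_orbits m"
      using K ne by (intro std_triple_orbits_equal_rows) auto
    then show ?thesis using K by (rule std_triple_orbits_transpose)
  next
    case 3
    with K show ?thesis by (intro std_triple_orbitsI(4) in_orbit_matching) auto
  qed
  then show ?thesis by (simp add: T e1 e2 e3)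
qed

text \<open>The four representatives have different colours and the colour is constant on orbits, so
  the colour identifies the orbit.\<close>

lemma triple_orbit_cases:
  assumes "T \<subseteq> K_graph m" "card T = 3"
  obtains "num_claws 2 T = 3" "T \<in> graph_orbit m std_star"
  | "num_claws 2 T = 2" "T \<in> graph_orbit m std_path"
  | "num_claws 2 T = 1" "T \<in> graph_orbit m std_mixed"
  | "num_claws 2 T = 0" "T \<in> graph_orbit m std_matching"
proof -
  from triple_in_std_orbit[OF assms]
  consider "T \<in> graph_orbit m std_star" | "T \<in> graph_orbit m std_path"
    | "T \<in> graph_orbit m std_mixed" | "T \<in> graph_orbit m std_matching"
    unfolding std_triple_orbits_def UN_simps by auto
  then show thesis
    using that num_claws_graph_orbit[of T m _ 2] std_colours by cases simp_all
qed

lemma in_orbit_adjacent_pair: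
  assumes "a \<in> {1..m}" "{b, c} \<subseteq> {1..m}" "b \<noteq> c"
  shows "{edge a b, edge a c} \<in> graph_orbit m {edge 1 1, edge 1 2}"
proof -
  obtain g where g: "g \<in> part_auts m"
    "\<forall>i<length [a]. \<forall>j<length [b, c]. g ` edge (Suc i) (Suc j) = edge ([a] ! i) ([b, c] ! j)"
    using ex_part_aut_list[of "[a]" m "[b, c]"] assms by auto
  have "graph_act g {edge 1 1, edge 1 2} = {edge a b, edge a c}"
    using g(2)[rule_format, of 0 0] g(2)[rule_format, of 0 1]
    by (simp add: graph_act_def numeral_2_eq_2)
  with g(1) show ?thesis by (rule graph_orbitI)
qed

lemma in_orbit_disjoint_pair:
  assumes "{a, c} \<subseteq> {1..m}" "{b, d} \<subseteq> {1..m}" "a \<noteq> c" "b \<noteq> d"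
  shows "{edge a b, edge c d} \<in> graph_orbit m {edge 1 1, edge 2 2}"
proof -
  obtain g where g: "g \<in> part_auts m"
    "\<forall>i<length [a, c]. \<forall>j<length [b, d]. g ` edge (Suc i) (Suc j) = edge ([a, c] ! i) ([b, d] ! j)"
    using ex_part_aut_list[of "[a, c]" m "[b, d]"] assms by auto
  have "graph_act g {edge 1 1, edge 2 2} = {edge a b, edge c d}"
    using g(2)[rule_format, of 0 0] g(2)[rule_format, of 1 1]
    by (simp add: graph_act_def numeral_2_eq_2)
  with g(1) show ?thesis by (rule graph_orbitI)
qed

lemma pair_orbit_cases:
  assumes "T \<subseteq> K_graph m" "card T = 2"
  obtains "num_claws 2 T = 1" "T \<in> graph_orbit m {edge 1 1, edge 1 2}"
  | "num_claws 2 T = 0" "T \<in> graph_orbit m {edge 1 1, edge 2 2}"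
proof -
  obtain e1 e2 where T: "T = {e1, e2}" and ne: "e1 \<noteq> e2"
    using assms(2) by (auto simp: card_2_iff)
  obtain a b where e1: "e1 = edge a b" using assms(1) T by (auto elim: K_graph_edgeE)
  obtain c d where e2: "e2 = edge c d" using assms(1) T by (auto elim: K_graph_edgeE)
  note K = assms(1)[unfolded T e1 e2] and ne = ne[unfolded e1 e2]
  have colours: "num_claws 2 {edge 1 1, edge 1 2} = 1" "num_claws 2 {edge 1 1, edge 2 2} = 0"
    by (simp_all add: num_claws_2_pair)
  have "T \<in> graph_orbit m {edge 1 1, edge 1 2} \<or> T \<in> graph_orbit m {edge 1 1, edge 2 2}"
  proof -
    consider "a = c" | "b = d" | "a \<noteq> c" "b \<noteq> d" by blast
    then show ?thesis
    proof cases
      case 1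
      with in_orbit_adjacent_pair[of a m b d] K ne show ?thesis by (simp add: T e1 e2)
    next
      case 2
      with in_orbit_adjacent_pair[of b m a c] K ne
      have "{edge b a, edge d c} \<in> graph_orbit m {edge 1 1, edge 1 2}" by simp
      from transpose_pair[OF this K] show ?thesis by (simp add: T e1 e2)
    next
      case 3
      with in_orbit_disjoint_pair[of a c m b d] K show ?thesis by (simp add: T e1 e2)
    qed
  qed
  with that colours num_claws_graph_orbit[of T m _ 2] show thesis by (elim disjE) simp_all
qed

lemma same_colour_connects:
  assumes "S \<subseteq> K_graph m" "T \<subseteq> K_graph m" "card S = t" "card T = t" "t = 2 \<or> t = 3"
    and "num_claws 2 S = num_claws 2 T"
  shows "\<exists>g\<in>part_auts m. T = graph_act g S"
proof -
  have "\<exists>F. \<forall>T. T \<subseteq> K_graph m \<longrightarrow> card T = t \<longrightarrow> T \<in> graph_orbit m (F (num_claws 2 T))"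
    using assms(5)
  proof
    assume t: "t = 2"
    show ?thesis
    proof (intro exI allI impI)
      fix T assume "T \<subseteq> K_graph m" "card T = t"
      \<comment> \<open>The last branch is meant for colour 0, the only other value that occurs on
        pairs.\<close>
      then show "T \<in> graph_orbit m ((\<lambda>j. if j = 1 then {edge 1 1, edge 1 2} else {edge 1 1, edge 2 2})
          (num_claws 2 T))"
        unfolding t by (rule pair_orbit_cases) simp_all
    qed
  next
    assume t: "t = 3"
    show ?thesis
    proof (intro exI allI impI)
      fix T assume "T \<subseteq> K_graph m" "card T = t"
      then show "T \<in> graph_orbit m ((\<lambda>j. if j = 3 then std_star else if j = 2 then std_path
          else if j = 1 then std_mixed else std_matching) (num_claws 2 T))"
        unfolding t by (rule triple_orbit_cases) simp_all
    qed
  qed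
  then obtain F where
    F: "\<And>T. T \<subseteq> K_graph m \<Longrightarrow> card T = t \<Longrightarrow> T \<in> graph_orbit m (F (num_claws 2 T))"
    by auto
  show ?thesis
    using F[OF assms(1,3)] F[OF assms(2,4)] graph_orbit_connects unfolding assms(6) by simp
qed

section \<open>Transport of block counts and colour counts\<close>

lemma graph_orbit_closed:
  assumes "g \<in> part_auts m"
  shows "graph_act g b \<in> graph_orbit m \<Delta> \<longleftrightarrow> b \<in> graph_orbit m \<Delta>"
proof
  assume "graph_act g b \<in> graph_orbit m \<Delta>"
  from graph_orbit_act[OF part_auts_inv[OF assms] this] show "b \<in> graph_orbit m \<Delta>"
    by (simp add: graph_act_inv bij_part_auts[OF assms])
qed (rule graph_orbit_act[OF assms])

text \<open>\<open>g\<close> permutes the blocks, so it maps those containing \<open>S\<close>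
  bijectively onto those containing the image of \<open>S\<close>.\<close>

lemma card_blocks_containing_act:
  assumes "g \<in> part_auts m"
  shows "card {b \<in> graph_orbit m \<Delta>. graph_act g S \<subseteq> b} = card {b \<in> graph_orbit m \<Delta>. S \<subseteq> b}"
proof -
  have bij: "bij g" using assms by (rule bij_part_auts)
  have "{b \<in> graph_orbit m \<Delta>. graph_act g S \<subseteq> b} = graph_act g ` {b \<in> graph_orbit m \<Delta>. S \<subseteq> b}"
  proof (intro equalityI subsetI)
    fix b assume b: "b \<in> {b \<in> graph_orbit m \<Delta>. graph_act g S \<subseteq> b}"
    define b' where "b' = graph_act (inv_into UNIV g) b"
    have "b = graph_act g b'" by (simp add: b'_def graph_act_inv[OF bij])
    with b show "b \<in> graph_act g ` {b \<in> graph_orbit m \<Delta>. S \<subseteq> b}"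
      by (simp add: graph_orbit_closed[OF assms] graph_act_mono_iff[OF bij])
  next
    fix b assume "b \<in> graph_act g ` {b \<in> graph_orbit m \<Delta>. S \<subseteq> b}"
    then obtain b' where "b = graph_act g b'" "b' \<in> graph_orbit m \<Delta>" "S \<subseteq> b'" by auto
    then show "b \<in> {b \<in> graph_orbit m \<Delta>. graph_act g S \<subseteq> b}"
      by (simp add: graph_orbit_closed[OF assms] graph_act_mono_iff[OF bij])
  qed
  then show ?thesis
    by (simp add: card_image inj_on_subset[OF inj_graph_act[OF bij]])
qed

text \<open>It plays two roles: for \<Delta> it is the count \<open>n j\<close> shared by all
  blocks, for \<open>K_graph m\<close> it is the size of a whole colour class.\<close>

definition colour_count :: "nat \<Rightarrow> 'v set set \<Rightarrow> nat \<Rightarrow> nat"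
  where "colour_count t \<Gamma> j = card {T. T \<subseteq> \<Gamma> \<and> card T = t \<and> num_claws 2 T = j}"

lemma colour_count_graph_act:
  assumes "bij g"
  shows "colour_count t (graph_act g \<Gamma>) j = colour_count t \<Gamma> j"
proof -
  let ?\<T> = "\<lambda>\<Gamma>. {T. T \<subseteq> \<Gamma> \<and> card T = t \<and> num_claws 2 T = j}"
  have "?\<T> (graph_act g \<Gamma>) = graph_act g ` ?\<T> \<Gamma>"
  proof (intro equalityI subsetI)
    fix T assume T: "T \<in> ?\<T> (graph_act g \<Gamma>)"
    define T' where "T' = graph_act (inv_into UNIV g) T"
    have "T = graph_act g T'" by (simp add: T'_def graph_act_inv[OF assms])
    with T show "T \<in> graph_act g ` ?\<T> \<Gamma>"
      by (simp add: graph_act_mono_iff[OF assms] card_graph_act[OF assms] num_claws_graph_act[OF assms])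
  next
    fix T assume "T \<in> graph_act g ` ?\<T> \<Gamma>"
    then obtain T' where "T = graph_act g T'" "T' \<subseteq> \<Gamma>" "card T' = t" "num_claws 2 T' = j" by auto
    then show "T \<in> ?\<T> (graph_act g \<Gamma>)"
      by (simp add: graph_act_mono_iff[OF assms] card_graph_act[OF assms] num_claws_graph_act[OF assms])
  qed
  then show ?thesis
    by (simp add: colour_count_def card_image inj_on_subset[OF inj_graph_act[OF assms]])
qed

text \<open>Both uniformity assumptions come from the group: all blocks are images of \<Delta>, and
  \<open>t\<close>-sets of equal colour are images of each other.\<close>

lemma homogeneous_family_graph_orbit:
  assumes "\<Delta> \<subseteq> K_graph m" "t = 2 \<or> t = 3"
  shows "homogeneous_family (K_graph m) (graph_orbit m \<Delta>) t (card \<Delta>) (num_claws 2) (colour_count t \<Delta>)"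
proof
  show "finite (graph_orbit m \<Delta>)"
  proof (rule finite_subset)
    show "graph_orbit m \<Delta> \<subseteq> Pow (K_graph m)"
      using graph_orbit_subset(1)[OF assms(1)] by (rule subsetI[OF PowI])
  qed simp
  show "card {T. T \<subseteq> b \<and> card T = t \<and> num_claws 2 T = j} = colour_count t \<Delta> j"
    if b: "b \<in> graph_orbit m \<Delta>" for b j
  proof -
    obtain g where "g \<in> part_auts m" "b = graph_act g \<Delta>"
      using b unfolding graph_orbit_def by auto
    then show ?thesis
      using colour_count_graph_act[OF bij_part_auts, of g m t \<Delta> j] by (simp add: colour_count_def)
  qed
  show "card {b \<in> graph_orbit m \<Delta>. S \<subseteq> b} = card {b \<in> graph_orbit m \<Delta>. T \<subseteq> b}"
    if ST: "S \<subseteq> K_graph m" "T \<subseteq> K_graph m" "card S = t" "card T = t" "num_claws 2 S = num_claws 2 T" for S T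
  proof -
    obtain g where "g \<in> part_auts m" "T = graph_act g S"
      using same_colour_connects[OF ST(1-4) assms(2) ST(5)] by (elim bexE)
    then show ?thesis by (simp add: card_blocks_containing_act)
  qed
  show "graph_orbit m \<Delta> \<noteq> {}" using graph_orbit_self[of \<Delta> m] unfolding ex_in_conv[symmetric] by (rule exI)
qed (use graph_orbit_subset[OF assms(1)] in simp_all)

subsection \<open>Counting triples by colour\<close>

text \<open>In a 3-path only the two end edges are disjoint, which gives colour 2. Conversely, the
  classification of triples makes \<open>E\<close> an image of \<open>std_path\<close>.\<close>

lemma is_path_3_iff_colour:
  assumes "E \<subseteq> K_graph m"
  shows "is_path 3 E \<longleftrightarrow> card E = 3 \<and> num_claws 2 E = 2"
proof
  assume "is_path 3 E"
  then obtain a b c d where d: "distinct [a, b, c, d]" and E: "E = {{a, b}, {b, c}, {c, d}}"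
    unfolding is_path_3_iff by blast
  have ne: "{a, b} \<noteq> {b, c}" "{a, b} \<noteq> {c, d}" "{b, c} \<noteq> {c, d}"
    using d by (auto simp: doubleton_eq_iff)
  then have "card E = 3" by (simp add: E)
  moreover have "num_claws 2 E = 2"
    unfolding E using ne d by (subst num_claws_2_triple) auto
  ultimately show "card E = 3 \<and> num_claws 2 E = 2" by simp
next
  assume E: "card E = 3 \<and> num_claws 2 E = 2"
  from assms E[THEN conjunct1] have "E \<in> graph_orbit m std_path"
    by (rule triple_orbit_cases) (simp_all add: E)
  then obtain g where g: "g \<in> part_auts m" "E = graph_act g std_path"
    unfolding graph_orbit_def by auto
  have "std_path = {{Row 2, Col 1}, {Col 1, Row 1}, {Row 1, Col 2}}"
    by (simp add: std_path_def edge_def insert_commute)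
  then have "is_path 3 std_path"
    unfolding is_path_3_iff
    by (intro exI[of _ "Row 2"] exI[of _ "Col 1"] exI[of _ "Row 1"] exI[of _ "Col 2"]) simp
  with g show "is_path 3 E"
    by (simp add: is_path_3_graph_act bij_is_inj bij_part_auts)
qed

text \<open>A triangle also has three meeting pairs; it is excluded because \<open>E\<close> lies in
  a bipartite graph, which enters through the classification of triples.\<close>

lemma is_claw_3_iff_colour:
  assumes "E \<subseteq> K_graph m"
  shows "is_claw 3 E \<longleftrightarrow> card E = 3 \<and> num_claws 2 E = 3"
proof -
  have claw: "is_claw 3 S \<longleftrightarrow> card S = 3 \<and> \<Inter> S \<noteq> {}" if "S \<subseteq> K_graph m" for S
    using that card_edge by (intro is_claw_iff) auto
  show ?thesis
  proof
    assume "is_claw 3 E"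
    then have E: "card E = 3" "\<Inter> E \<noteq> {}" using claw[OF assms] by simp_all
    then obtain e1 e2 e3 where T: "E = {e1, e2, e3}" and ne: "e1 \<noteq> e2" "e1 \<noteq> e3" "e2 \<noteq> e3"
      by (auto simp: card_3_iff)
    have "card e1 = 2" "card e2 = 2" "card e3 = 2" using T assms card_edge by auto
    moreover have "e1 \<inter> e2 \<noteq> {}" "e1 \<inter> e3 \<noteq> {}" "e2 \<inter> e3 \<noteq> {}" using E(2) T by auto
    ultimately have "num_claws 2 E = 3" unfolding T using ne by (subst num_claws_2_triple) auto
    with E show "card E = 3 \<and> num_claws 2 E = 3" by simp
  next
    assume E: "card E = 3 \<and> num_claws 2 E = 3"
    from assms E[THEN conjunct1] have "E \<in> graph_orbit m std_star"
      by (rule triple_orbit_cases) (simp_all add: E)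
    then obtain g where g: "g \<in> part_auts m" "E = graph_act g std_star"
      unfolding graph_orbit_def by auto
    have "Row 1 \<in> \<Inter> std_star" "card std_star = 3" by (simp_all add: std_star_def edge_def doubleton_eq_iff)
    moreover have "card e = 2" if "e \<in> std_star" for e using that by (auto simp: std_star_def)
    ultimately have "is_claw 3 std_star" by (subst is_claw_iff) auto
    with g show "is_claw 3 E"
      by (simp add: is_claw_graph_act bij_is_inj bij_part_auts)
  qed
qed

lemma is_claw_2_iff_colour:
  assumes "E \<subseteq> K_graph m"
  shows "is_claw 2 E \<longleftrightarrow> card E = 2 \<and> num_claws 2 E = 1"
proof -
  have claw: "is_claw 2 E \<longleftrightarrow> card E = 2 \<and> \<Inter> E \<noteq> {}"
    using assms card_edge by (intro is_claw_iff) auto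
  have "\<Inter> E \<noteq> {} \<longleftrightarrow> num_claws 2 E = 1" if E: "card E = 2"
  proof -
    obtain e1 e2 where T: "E = {e1, e2}" "e1 \<noteq> e2" using E by (auto simp: card_2_iff)
    then have "card e1 = 2" "card e2 = 2" using assms card_edge by auto
    with T show ?thesis by (simp add: num_claws_2_pair)
  qed
  with claw show ?thesis by blast
qed

lemma colour_count_2_1:
  assumes "\<Gamma> \<subseteq> K_graph m"
  shows "colour_count 2 \<Gamma> 1 = num_claws 2 \<Gamma>"
proof -
  have "T \<subseteq> \<Gamma> \<and> card T = 2 \<and> num_claws 2 T = 1 \<longleftrightarrow> T \<subseteq> \<Gamma> \<and> is_claw 2 T" for T
    using is_claw_2_iff_colour[of T m] assms by (meson subset_trans)
  then show ?thesis unfolding colour_count_def num_claws_def by simp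
qed

lemma colour_count_3_3:
  assumes "\<Gamma> \<subseteq> K_graph m"
  shows "colour_count 3 \<Gamma> 3 = num_claws 3 \<Gamma>"
proof -
  have "T \<subseteq> \<Gamma> \<and> card T = 3 \<and> num_claws 2 T = 3 \<longleftrightarrow> T \<subseteq> \<Gamma> \<and> is_claw 3 T" for T
    using is_claw_3_iff_colour[of T m] assms by (meson subset_trans)
  then have "colour_count 3 \<Gamma> 3 = card {T. T \<subseteq> \<Gamma> \<and> is_claw 3 T}"
    unfolding colour_count_def by simp
  then show ?thesis unfolding num_claws_def .
qed

lemma colour_count_3_2:
  assumes "\<Gamma> \<subseteq> K_graph m"
  shows "colour_count 3 \<Gamma> 2 = num_paths 3 \<Gamma>"
proof -
  have "T \<subseteq> \<Gamma> \<and> card T = 3 \<and> num_claws 2 T = 2 \<longleftrightarrow> T \<subseteq> \<Gamma> \<and> is_path 3 T" for T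
    using is_path_3_iff_colour[of T m] assms by (meson subset_trans)
  then show ?thesis unfolding colour_count_def num_paths_def by simp
qed

lemma colour_pair_le:
  assumes "T \<subseteq> K_graph m" "card T = 2"
  shows "num_claws 2 T \<le> 1"
  using assms by (rule pair_orbit_cases) simp_all

lemma colour_triple_le:
  assumes "T \<subseteq> K_graph m" "card T = 3"
  shows "num_claws 2 T \<le> 3"
  using assms by (rule triple_orbit_cases) simp_all

text \<open>The weight \<open>f\<close> is kept general: the constant 1 yields the number of
  \<open>t\<close>-sets, the identity yields their total colour.\<close>

lemma sum_colour:
  assumes "finite \<Gamma>" and bound: "\<And>T. T \<subseteq> \<Gamma> \<Longrightarrow> card T = t \<Longrightarrow> num_claws 2 T \<le> r"
  shows "(\<Sum>T | T \<subseteq> \<Gamma> \<and> card T = t. f (num_claws 2 T)) = (\<Sum>j\<le>r. f j * colour_count t \<Gamma> j)"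
proof -
  let ?\<T> = "{T. T \<subseteq> \<Gamma> \<and> card T = t}"
  have "(\<Sum>T\<in>?\<T>. f (num_claws 2 T)) = (\<Sum>j\<le>r. \<Sum>T | T \<in> ?\<T> \<and> num_claws 2 T = j. f (num_claws 2 T))"
    using assms(1) bound by (intro sum.group[symmetric]) auto
  also have "\<dots> = (\<Sum>j\<le>r. f j * colour_count t \<Gamma> j)"
  proof (rule sum.cong[OF refl])
    fix j
    have "(\<Sum>T | T \<in> ?\<T> \<and> num_claws 2 T = j. f (num_claws 2 T)) = (\<Sum>T | T \<in> ?\<T> \<and> num_claws 2 T = j. f j)"
      by (rule sum.cong) auto
    also have "\<dots> = f j * colour_count t \<Gamma> j" by (simp add: colour_count_def)
    finally show "(\<Sum>T | T \<in> ?\<T> \<and> num_claws 2 T = j. f (num_claws 2 T)) = f j * colour_count t \<Gamma> j" .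
  qed
  finally show ?thesis .
qed

lemma colour_count_2_total:
  assumes "\<Gamma> \<subseteq> K_graph m"
  shows "colour_count 2 \<Gamma> 0 + colour_count 2 \<Gamma> 1 = card \<Gamma> choose 2"
proof -
  have fin: "finite \<Gamma>" using assms by (rule finite_subset) simp
  have "(\<Sum>T | T \<subseteq> \<Gamma> \<and> card T = 2. 1) = (\<Sum>j\<le>1. 1 * colour_count 2 \<Gamma> j)"
    using assms by (intro sum_colour[OF fin] colour_pair_le[of _ m]) auto
  then show ?thesis using fin by (simp add: n_subsets)
qed

lemma colour_count_3_total:
  assumes "\<Gamma> \<subseteq> K_graph m"
  shows "colour_count 3 \<Gamma> 0 + colour_count 3 \<Gamma> 1 + colour_count 3 \<Gamma> 2 + colour_count 3 \<Gamma> 3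
    = card \<Gamma> choose 3"
proof -
  have fin: "finite \<Gamma>" using assms by (rule finite_subset) simp
  have "(\<Sum>T | T \<subseteq> \<Gamma> \<and> card T = 3. 1) = (\<Sum>j\<le>3. 1 * colour_count 3 \<Gamma> j)"
    using assms by (intro sum_colour[OF fin] colour_triple_le[of _ m]) auto
  then show ?thesis using fin by (simp add: n_subsets numeral_3_eq_3 numeral_2_eq_2 atMost_Suc)
qed

lemma card_triples_containing_pair:
  assumes "finite \<Gamma>" "S \<subseteq> \<Gamma>" "card S = 2"
  shows "card {T. T \<subseteq> \<Gamma> \<and> card T = 3 \<and> S \<subseteq> T} = card \<Gamma> - 2"
proof -
  have finS: "finite S" using assms by (auto intro: finite_subset)
  have "{T. T \<subseteq> \<Gamma> \<and> card T = 3 \<and> S \<subseteq> T} = (\<lambda>e. insert e S) ` (\<Gamma> - S)"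
  proof (intro equalityI subsetI)
    fix T assume T: "T \<in> {T. T \<subseteq> \<Gamma> \<and> card T = 3 \<and> S \<subseteq> T}"
    then have "card (T - S) = 1" using assms(3) finS by (simp add: card_Diff_subset)
    then obtain e where e: "T - S = {e}" by (rule card_1_singletonE)
    then have "T = insert e S" "e \<in> \<Gamma> - S" using T by auto
    then show "T \<in> (\<lambda>e. insert e S) ` (\<Gamma> - S)" by (rule image_eqI)
  next
    fix T assume "T \<in> (\<lambda>e. insert e S) ` (\<Gamma> - S)"
    then obtain e where "e \<in> \<Gamma>" "e \<notin> S" "T = insert e S" by auto
    with assms finS show "T \<in> {T. T \<subseteq> \<Gamma> \<and> card T = 3 \<and> S \<subseteq> T}" by auto
  qed
  moreover have "inj_on (\<lambda>e. insert e S) (\<Gamma> - S)"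
  proof (rule inj_onI)
    fix x y assume "x \<in> \<Gamma> - S" "insert x S = insert y S"
    then have "x \<in> insert y S" "x \<notin> S" by blast+
    then show "x = y" by simp
  qed
  ultimately show ?thesis
    using assms finS by (simp add: card_image card_Diff_subset)
qed

text \<open>Pairs of a 2-claw and a triple containing it are counted twice: by triples they add up
  the colours, by 2-claws there are \<open>card \<Gamma> - 2\<close> choices for the third
  edge.\<close>

lemma colour_count_3_weighted:
  assumes "\<Gamma> \<subseteq> K_graph m"
  shows "colour_count 3 \<Gamma> 1 + 2 * colour_count 3 \<Gamma> 2 + 3 * colour_count 3 \<Gamma> 3
    = (card \<Gamma> - 2) * num_claws 2 \<Gamma>"
proof -
  have fin: "finite \<Gamma>" using assms by (rule finite_subset) simp
  let ?\<S> = "{S. S \<subseteq> \<Gamma> \<and> is_claw 2 S}" and ?\<T> = "{T. T \<subseteq> \<Gamma> \<and> card T = 3}"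
  have "{S \<in> ?\<S>. S \<subseteq> T} = {S. S \<subseteq> T \<and> is_claw 2 S}" if "T \<in> ?\<T>" for T
    using that by auto
  then have "(\<Sum>T\<in>?\<T>. num_claws 2 T) = (\<Sum>T\<in>?\<T>. card {S \<in> ?\<S>. S \<subseteq> T})"
    by (simp add: num_claws_def)
  also have "\<dots> = (\<Sum>S\<in>?\<S>. card \<Gamma> - 2)"
  proof (rule sum_multicount_gen)
    show "\<forall>S\<in>?\<S>. card {T \<in> ?\<T>. S \<subseteq> T} = card \<Gamma> - 2"
    proof
      fix S assume S: "S \<in> ?\<S>"
      then have "S \<subseteq> \<Gamma>" "card S = 2" using is_claw_2_iff_colour[of S m] assms by auto
      from card_triples_containing_pair[OF fin this] show "card {T \<in> ?\<T>. S \<subseteq> T} = card \<Gamma> - 2"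
        by (simp add: conj_assoc)
    qed
  qed (use fin in auto)
  finally have "(\<Sum>T\<in>?\<T>. num_claws 2 T) = (card \<Gamma> - 2) * num_claws 2 \<Gamma>"
    by (simp add: num_claws_def mult.commute)
  moreover have "(\<Sum>T | T \<subseteq> \<Gamma> \<and> card T = 3. num_claws 2 T) = (\<Sum>j\<le>3. j * colour_count 3 \<Gamma> j)"
    using assms by (intro sum_colour[OF fin] colour_triple_le[of _ m]) auto
  ultimately show ?thesis by (simp add: numeral_3_eq_3 numeral_2_eq_2 atMost_Suc)
qed

text \<open>Settles the colours that never occur, since \<open>balanced\<close> asks for an equation
  at every natural number.\<close>

lemma colour_count_eq_0:
  assumes "\<And>T. T \<subseteq> \<Gamma> \<Longrightarrow> card T = t \<Longrightarrow> num_claws 2 T \<le> r" "r < j"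
  shows "colour_count t \<Gamma> j = 0"
proof -
  have "{T. T \<subseteq> \<Gamma> \<and> card T = t \<and> num_claws 2 T = j} = {}" (is "?\<T> = {}")
  proof (rule equals0I)
    fix T assume "T \<in> ?\<T>"
    then show False using assms(1)[of T] assms(2) by simp
  qed
  then show ?thesis unfolding colour_count_def by (simp only: card.empty)
qed

section \<open>Counts in the complete bipartite graph\<close>

lemma vertex_degree_K_graph:
  assumes "i \<in> {1..m}"
  shows "vertex_degree (K_graph m) (Row i) = m" "vertex_degree (K_graph m) (Col i) = m"
proof -
  have "{e \<in> K_graph m. Row i \<in> e} = edge i ` {1..m}" "{e \<in> K_graph m. Col i \<in> e} = (\<lambda>j. edge j i) ` {1..m}"
    using assms by (auto elim!: K_graph_edgeE) (auto simp: edge_def)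
  then show "vertex_degree (K_graph m) (Row i) = m" "vertex_degree (K_graph m) (Col i) = m"
    by (simp_all add: vertex_degree_def card_image inj_on_def)
qed

lemma num_claws_K_graph:
  assumes "2 \<le> u"
  shows "num_claws u (K_graph m) = 2 * m * (m choose u)"
  using num_claws_eq_sum[OF subset_refl assms, of m] by (simp add: vertex_degree_K_graph)

text \<open>A 3-path is fixed by its middle edge \<open>edge a b\<close>, its end column
  \<open>c\<close> and its end row \<open>d\<close>. The ordered pairs \<open>(a, d)\<close> and
  \<open>(b, c)\<close> of distinct indices are independent, with m (m - 1) choices each.\<close>

lemma num_paths_3_K_graph: "num_paths 3 (K_graph m) = (m * (m - 1)) ^ 2"
proof -
  let ?D = "{1..m} \<times> {1..m} - Id_on {1..m}"
  let ?f = "\<lambda>((a, d), (b, c)). {edge a b, edge a c, edge d b}"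
  have "card (Id_on {1..m}) = m"
  proof -
    have "Id_on {1..m} = (\<lambda>i. (i, i)) ` {1..m}" by auto
    then show ?thesis by (simp add: card_image inj_on_def)
  qed
  moreover have "Id_on {1..m} \<subseteq> {1..m} \<times> {1..m}" by auto
  ultimately have card_D: "card ?D = m * (m - 1)"
    by (subst card_Diff_subset) (auto intro: finite_subset simp: card_cartesian_product diff_mult_distrib2)
  have "inj_on ?f (?D \<times> ?D)"
  proof (rule inj_onI)
    fix u v assume u: "u \<in> ?D \<times> ?D" and v: "v \<in> ?D \<times> ?D" and uv: "?f u = ?f v"
    obtain a d b c where u': "u = ((a, d), (b, c))" by (metis surj_pair)
    obtain a' d' b' c' where v': "v = ((a', d'), (b', c'))" by (metis surj_pair)
    have eq: "{edge a b, edge a c, edge d b} = {edge a' b', edge a' c', edge d' b'}"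
      using uv by (simp add: u' v')
    have "edge a b \<in> {edge a' b', edge a' c', edge d' b'}" "edge a c \<in> {edge a' b', edge a' c', edge d' b'}"
      "edge d b \<in> {edge a' b', edge a' c', edge d' b'}"
      unfolding eq[symmetric] by simp_all
    moreover have "a \<noteq> d" "b \<noteq> c" "a' \<noteq> d'" "b' \<noteq> c'" using u v by (auto simp: u' v')
    ultimately show "u = v" by (auto simp: u' v')
  qed
  moreover have "{E. E \<subseteq> K_graph m \<and> is_path 3 E} = ?f ` (?D \<times> ?D)"
  proof (intro equalityI subsetI)
    fix E assume "E \<in> {E. E \<subseteq> K_graph m \<and> is_path 3 E}"
    then have K: "E \<subseteq> K_graph m" and "is_path 3 E" by auto
    then obtain p q r s where pq: "distinct [p, q, r, s]" "E = {{p, q}, {q, r}, {r, s}}"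
      unfolding is_path_3_iff by blast
    have K: "{p, q} \<in> K_graph m" "{q, r} \<in> K_graph m" "{r, s} \<in> K_graph m" using K pq by auto
    show "E \<in> ?f ` (?D \<times> ?D)"
    \<comment> \<open>Read from its other end, a path has its second vertex in the other part, so
      both cases lead to the same parametrisation.\<close>
    proof (cases q)
      case (Row a)
      obtain c where p: "p = Col c" using K(1) Row by (auto simp: mem_K_graph doubleton_eq_iff)
      obtain b where r: "r = Col b" using K(2) Row by (auto simp: mem_K_graph doubleton_eq_iff)
      obtain d where s: "s = Row d" using K(3) r by (auto simp: mem_K_graph doubleton_eq_iff)
      have "E = ?f ((a, d), (b, c))"
        by (auto simp: pq(2) Row p r s edge_def)
      moreover have "edge a c \<in> K_graph m" "edge d b \<in> K_graph m"
        using K Row p r s by (simp_all add: edge_def insert_commute)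
      then have "((a, d), (b, c)) \<in> ?D \<times> ?D"
        using pq(1) by (auto simp: Row p r s)
      ultimately show ?thesis by (rule image_eqI)
    next
      case (Col b)
      obtain d where p: "p = Row d" using K(1) Col by (auto simp: mem_K_graph doubleton_eq_iff)
      obtain a where r: "r = Row a" using K(2) Col by (auto simp: mem_K_graph doubleton_eq_iff)
      obtain c where s: "s = Col c" using K(3) r by (auto simp: mem_K_graph doubleton_eq_iff)
      have "E = ?f ((a, d), (b, c))"
        by (auto simp: pq(2) Col p r s edge_def)
      moreover have "edge a c \<in> K_graph m" "edge d b \<in> K_graph m"
        using K Col p r s by (simp_all add: edge_def insert_commute)
      then have "((a, d), (b, c)) \<in> ?D \<times> ?D"
        using pq(1) by (auto simp: Col p r s)
      ultimately show ?thesis by (rule image_eqI)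
    qed
  next
    fix E assume "E \<in> ?f ` (?D \<times> ?D)"
    then obtain u where u: "u \<in> ?D \<times> ?D" "E = ?f u" by (elim imageE)
    obtain a d b c where u': "u = ((a, d), (b, c))" by (metis surj_pair)
    have r: "a \<in> {1..m}" "d \<in> {1..m}" "b \<in> {1..m}" "c \<in> {1..m}" and ne: "a \<noteq> d" "b \<noteq> c"
      using u(1) by (auto simp: u')
    have E: "E = {edge a b, edge a c, edge d b}" using u(2) by (simp add: u')
    have "E = {{Col c, Row a}, {Row a, Col b}, {Col b, Row d}}"
      by (simp add: E edge_def insert_commute)
    then have "is_path 3 E"
      using ne unfolding is_path_3_iff
      by (intro exI[of _ "Col c"] exI[of _ "Row a"] exI[of _ "Col b"] exI[of _ "Row d"]) simp
    with E r show "E \<in> {E. E \<subseteq> K_graph m \<and> is_path 3 E}" by simp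
  qed
  ultimately show ?thesis
    unfolding num_paths_def
    by (simp only: card_image card_cartesian_product card_D power2_eq_square)
qed

subsection \<open>Balance conditions\<close>

text \<open>The polynomial vanishes at 0 and 1, so the formula covers every natural number and
  avoids truncated subtraction.\<close>

lemma real_choose_2: "real (n choose 2) = real n * (real n - 1) / 2"
proof (induction n)
  case (Suc n)
  have "Suc n choose 2 = n + (n choose 2)" by (simp add: numeral_2_eq_2)
  with Suc show ?case by (simp add: field_simps)
qed simp

lemma real_choose_3: "real (n choose 3) = real n * (real n - 1) * (real n - 2) / 6"
proof (induction n)
  case (Suc n)
  have "Suc n choose 3 = (n choose 2) + (n choose 3)" by (simp add: numeral_3_eq_3 numeral_2_eq_2)
  with Suc show ?case by (simp add: real_choose_2 field_simps)
qed simp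

lemma colour_count_2_eq_0: "\<Gamma> \<subseteq> K_graph m \<Longrightarrow> 1 < j \<Longrightarrow> colour_count 2 \<Gamma> j = 0"
  by (rule colour_count_eq_0[OF colour_pair_le[OF subset_trans]])

lemma colour_count_3_eq_0: "\<Gamma> \<subseteq> K_graph m \<Longrightarrow> 3 < j \<Longrightarrow> colour_count 3 \<Gamma> j = 0"
  by (rule colour_count_eq_0[OF colour_triple_le[OF subset_trans]])

text \<open>Equality of the proportions in \<Delta> and in the complete graph, cross-multiplied to
  stay within the natural numbers.\<close>

definition balanced :: "nat \<Rightarrow> nat \<Rightarrow> vertex set set \<Rightarrow> bool"
  where "balanced t m \<Delta> \<longleftrightarrow> (\<forall>j.
    colour_count t \<Delta> j * (m ^ 2 choose t) = (card \<Delta> choose t) * colour_count t (K_graph m) j)"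

text \<open>The replication identity expresses \<open>l\<close> through the number of blocks, and
  the orbit-stabiliser theorem turns that number into 2 (m!)^2 divided by the order of the
  stabiliser.\<close>

lemma D_hat_design_balanced:
  assumes "0 < m" "\<Delta> \<subseteq> K_graph m" "t = 2 \<or> t = 3" "t \<le> card \<Delta>"
  shows "is_t_design t (D_hat m \<Delta>) \<longleftrightarrow> balanced t m \<Delta>"
    and "balanced t m \<Delta> \<Longrightarrow> \<exists>l. is_design t (m ^ 2) (card \<Delta>) l (D_hat m \<Delta>) \<and>
      real l = 2 * fact m ^ 2 * real (card \<Delta> choose t)
        / (real (m ^ 2 choose t) * real (card (graph_stabilizer m \<Delta>)))"
proof -
  let ?\<B> = "graph_orbit m \<Delta>" and ?s = "card (graph_stabilizer m \<Delta>)"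
  interpret homogeneous_family "K_graph m" ?\<B> t "card \<Delta>" "num_claws 2" "colour_count t \<Delta>"
    using assms(2,3) by (rule homogeneous_family_graph_orbit)
  have t: "0 < t" "0 < card \<Delta>" using assms(3,4) by auto
  have le: "t \<le> card (K_graph m)"
    using assms(4) card_mono[OF finite_K_graph assms(2)] by linarith
  have bal: "balanced t m \<Delta> \<longleftrightarrow>
    (\<exists>l. \<forall>T. T \<subseteq> K_graph m \<and> card T = t \<longrightarrow> card {b \<in> ?\<B>. T \<subseteq> b} = l)"
    using balanced_iff[OF le] by (simp add: balanced_def colour_count_def)
  \<comment> \<open>\<open>is_design\<close> demands a positive \<open>l\<close>; it is positive
    since blocks exist and each of them has \<open>t\<close>-subsets.\<close>
  have l: "0 < l \<and> l * (m ^ 2 choose t) = card ?\<B> * (card \<Delta> choose t)"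
    if "\<forall>T. T \<subseteq> K_graph m \<and> card T = t \<longrightarrow> card {b \<in> ?\<B>. T \<subseteq> b} = l" for l
  proof -
    have eq: "l * (m ^ 2 choose t) = card ?\<B> * (card \<Delta> choose t)"
      using replication_number[of l] that by simp
    have "0 < card ?\<B> * (card \<Delta> choose t)"
      using assms(4) finite_family nonempty_family by (simp add: card_gt_0_iff)
    then show ?thesis using eq by (metis mult_0 neq0_conv)
  qed
  note design = D_hat_design_iff[OF assms(1) t(1) t(2) assms(2)]
  show "is_t_design t (D_hat m \<Delta>) \<longleftrightarrow> balanced t m \<Delta>"
    unfolding is_t_design_def design bal using l by auto
  assume "balanced t m \<Delta>"
  then obtain l where L: "\<forall>T. T \<subseteq> K_graph m \<and> card T = t \<longrightarrow> card {b \<in> ?\<B>. T \<subseteq> b} = l"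
    unfolding bal by (rule exE)
  have "is_design t (m ^ 2) (card \<Delta>) l (D_hat m \<Delta>)"
    unfolding design using L l[OF L] by (intro conjI) simp_all
  moreover have "real l = 2 * fact m ^ 2 * real (card \<Delta> choose t) / (real (m ^ 2 choose t) * real ?s)"
  proof -
    have orb: "real (card ?\<B>) * real ?s = 2 * fact m ^ 2"
      using card_graph_orbit[OF assms(1), of \<Delta>]
      by (metis of_nat_fact of_nat_mult of_nat_numeral of_nat_power)
    \<comment> \<open>An infinite stabiliser would have \<open>card\<close> 0; the product with the
      orbit size, being nonzero, rules this out.\<close>
    have s: "real ?s \<noteq> 0"
    proof
      assume "real ?s = 0"
      with orb show False by simp
    qed
    have v: "real (m ^ 2 choose t) \<noteq> 0" using le by simp
    have "real l * real (m ^ 2 choose t) = real (card ?\<B>) * real (card \<Delta> choose t)"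
      using l[OF L] by (metis of_nat_mult)
    then have "real l * (real (m ^ 2 choose t) * real ?s) = (real (card ?\<B>) * real ?s) * real (card \<Delta> choose t)"
      by simp
    then show ?thesis unfolding orb using s v by (simp add: nonzero_eq_divide_eq)
  qed
  ultimately show "\<exists>l. is_design t (m ^ 2) (card \<Delta>) l (D_hat m \<Delta>) \<and>
      real l = 2 * fact m ^ 2 * real (card \<Delta> choose t) / (real (m ^ 2 choose t) * real ?s)"
    by (intro exI[of _ l] conjI)
qed

text \<open>Pairs have only the colours 0 and 1, and the two counts add up to a binomial
  coefficient, so balance at colour 1 implies balance at colour 0.\<close>

lemma balanced_2_iff:
  assumes "\<Delta> \<subseteq> K_graph m"
  shows "balanced 2 m \<Delta> \<longleftrightarrow>
    num_claws 2 \<Delta> * (m ^ 2 choose 2) = (card \<Delta> choose 2) * num_claws 2 (K_graph m)"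
proof
  assume "balanced 2 m \<Delta>"
  then have "colour_count 2 \<Delta> 1 * (m ^ 2 choose 2) = (card \<Delta> choose 2) * colour_count 2 (K_graph m) 1"
    unfolding balanced_def by (rule spec)
  then show "num_claws 2 \<Delta> * (m ^ 2 choose 2) = (card \<Delta> choose 2) * num_claws 2 (K_graph m)"
    using colour_count_2_1[OF assms] colour_count_2_1[OF subset_refl, of m] by simp
next
  let ?a = "colour_count 2 \<Delta>" and ?A = "colour_count 2 (K_graph m)"
  let ?C = "card \<Delta> choose 2" and ?V = "m ^ 2 choose 2"
  assume "num_claws 2 \<Delta> * ?V = ?C * num_claws 2 (K_graph m)"
  then have 1: "?a 1 * ?V = ?C * ?A 1"
    using colour_count_2_1[OF assms] colour_count_2_1[OF subset_refl, of m] by simp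
  have "?a 0 + ?a 1 = ?C" "?A 0 + ?A 1 = ?V"
    using colour_count_2_total[OF assms] colour_count_2_total[OF subset_refl, of m] by simp_all
  then have "(?a 0 + ?a 1) * ?V = ?C * (?A 0 + ?A 1)" by simp
  with 1 have 0: "?a 0 * ?V = ?C * ?A 0" by (simp add: algebra_simps)
  show "balanced 2 m \<Delta>"
    unfolding balanced_def
  proof
    fix j :: nat
    consider "j = 0" | "j = 1" | "1 < j" by linarith
    then show "?a j * ?V = ?C * ?A j"
    proof cases
      case 3
      then have "?a j = 0" "?A j = 0"
        using colour_count_2_eq_0[OF assms] colour_count_2_eq_0[OF subset_refl, of j m] by simp_all
      then show ?thesis by simp
    qed (use 0 1 in simp_all)
  qed
qed

text \<open>The factor n - 2 is the number of triples through a given pair among \<open>n\<close>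
  edges; it links the 2-path conditions for \<open>t = 2\<close> and \<open>t = 3\<close>.\<close>

lemma choose_3_eq: "3 * real (n choose 3) = (real n - 2) * real (n choose 2)"
  by (simp add: real_choose_2 real_choose_3)

lemma balanced_3_iff:
  assumes "\<Delta> \<subseteq> K_graph m" "3 \<le> card \<Delta>"
  shows "balanced 3 m \<Delta> \<longleftrightarrow>
    num_claws 2 \<Delta> * (m ^ 2 choose 2) = (card \<Delta> choose 2) * num_claws 2 (K_graph m) \<and>
    num_claws 3 \<Delta> * (m ^ 2 choose 3) = (card \<Delta> choose 3) * num_claws 3 (K_graph m) \<and>
    num_paths 3 \<Delta> * (m ^ 2 choose 3) = (card \<Delta> choose 3) * num_paths 3 (K_graph m)"
proof -
  let ?a = "colour_count 3 \<Delta>" and ?A = "colour_count 3 (K_graph m)"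
  let ?C = "card \<Delta> choose 3" and ?V = "m ^ 2 choose 3"
  let ?B = "card \<Delta> choose 2" and ?W = "m ^ 2 choose 2"
  let ?n = "num_claws 2 \<Delta>" and ?N = "num_claws 2 (K_graph m)"
  have v: "3 \<le> m ^ 2" using assms card_mono[OF finite_K_graph assms(1)] by simp
  have tot: "?a 0 + ?a 1 + ?a 2 + ?a 3 = ?C" "?A 0 + ?A 1 + ?A 2 + ?A 3 = ?V"
    using colour_count_3_total[OF assms(1)] colour_count_3_total[OF subset_refl, of m] by simp_all
  have w: "?a 1 + 2 * ?a 2 + 3 * ?a 3 = (card \<Delta> - 2) * ?n"
    "?A 1 + 2 * ?A 2 + 3 * ?A 3 = (m ^ 2 - 2) * ?N"
    using colour_count_3_weighted[OF assms(1)] colour_count_3_weighted[OF subset_refl, of m] by simp_all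
  note cc = colour_count_3_3[OF assms(1)] colour_count_3_3[OF subset_refl, of m]
    colour_count_3_2[OF assms(1)] colour_count_3_2[OF subset_refl, of m]
  \<comment> \<open>After multiplication by 3, both sides of the left equation carry the factor (k -
    2)(m^2 - 2), where k is \<open>card \<Delta>\<close>; it is positive and cancels.\<close>
  have weighted: "(card \<Delta> - 2) * ?n * ?V = ?C * ((m ^ 2 - 2) * ?N) \<longleftrightarrow> ?n * ?W = ?B * ?N"
  proof -
    have C: "3 * ?C = (card \<Delta> - 2) * ?B"
    proof -
      have "real (3 * ?C) = real ((card \<Delta> - 2) * ?B)"
        using choose_3_eq[of "card \<Delta>"] assms(2) by (simp add: of_nat_diff)
      then show ?thesis by (rule of_nat_eq_iff[THEN iffD1])
    qed
    have V: "3 * ?V = (m ^ 2 - 2) * ?W"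
    proof -
      have "real (3 * ?V) = real ((m ^ 2 - 2) * ?W)"
        using choose_3_eq[of "m ^ 2"] v by (simp add: of_nat_diff)
      then show ?thesis by (rule of_nat_eq_iff[THEN iffD1])
    qed
    have "3 * ((card \<Delta> - 2) * ?n * ?V) = (card \<Delta> - 2) * ?n * (3 * ?V)" by simp
    also have "\<dots> = ((card \<Delta> - 2) * (m ^ 2 - 2)) * (?n * ?W)" unfolding V by simp
    finally have L: "3 * ((card \<Delta> - 2) * ?n * ?V) = ((card \<Delta> - 2) * (m ^ 2 - 2)) * (?n * ?W)" .
    have "3 * (?C * ((m ^ 2 - 2) * ?N)) = (3 * ?C) * ((m ^ 2 - 2) * ?N)" by simp
    also have "\<dots> = ((card \<Delta> - 2) * (m ^ 2 - 2)) * (?B * ?N)" unfolding C by simp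
    finally have R: "3 * (?C * ((m ^ 2 - 2) * ?N)) = ((card \<Delta> - 2) * (m ^ 2 - 2)) * (?B * ?N)" .
    have "0 < (card \<Delta> - 2) * (m ^ 2 - 2)" using assms(2) v by simp
    then show ?thesis using L R by (metis mult_cancel1 neq0_conv zero_neq_numeral)
  qed
  show ?thesis
  proof
    assume "balanced 3 m \<Delta>"
    then have b: "?a j * ?V = ?C * ?A j" for j unfolding balanced_def by (rule spec)
    \<comment> \<open>The balance equations are linear in the counts, so they can be added with the
      colours as weights.\<close>
    have "(?a 1 + 2 * ?a 2 + 3 * ?a 3) * ?V = ?C * (?A 1 + 2 * ?A 2 + 3 * ?A 3)"
      using b[of 1] b[of 2] b[of 3] by (simp add: algebra_simps)
    then have "?n * ?W = ?B * ?N" unfolding w weighted .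
    with b[of 2] b[of 3] show "?n * ?W = ?B * ?N \<and> num_claws 3 \<Delta> * ?V = ?C * num_claws 3 (K_graph m)
      \<and> num_paths 3 \<Delta> * ?V = ?C * num_paths 3 (K_graph m)"
      unfolding cc by simp
  next
    assume "?n * ?W = ?B * ?N \<and> num_claws 3 \<Delta> * ?V = ?C * num_claws 3 (K_graph m)
      \<and> num_paths 3 \<Delta> * ?V = ?C * num_paths 3 (K_graph m)"
    then have n: "?n * ?W = ?B * ?N" and 3: "?a 3 * ?V = ?C * ?A 3" and 2: "?a 2 * ?V = ?C * ?A 2"
      unfolding cc by simp_all
    from n have "(?a 1 + 2 * ?a 2 + 3 * ?a 3) * ?V = ?C * (?A 1 + 2 * ?A 2 + 3 * ?A 3)"
      unfolding w weighted .
    with 2 3 have 1: "?a 1 * ?V = ?C * ?A 1" by (simp add: algebra_simps)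
    have "(?a 0 + ?a 1 + ?a 2 + ?a 3) * ?V = ?C * (?A 0 + ?A 1 + ?A 2 + ?A 3)"
      unfolding tot ..
    with 1 2 3 have 0: "?a 0 * ?V = ?C * ?A 0" by (simp add: algebra_simps)
    show "balanced 3 m \<Delta>"
      unfolding balanced_def
    proof
      fix j :: nat
      consider "j = 0" | "j = 1" | "j = 2" | "j = 3" | "3 < j" by linarith
      then show "?a j * ?V = ?C * ?A j"
      proof cases
        case 5
        then have "?a j = 0" "?A j = 0"
          using colour_count_3_eq_0[OF assms(1)] colour_count_3_eq_0[OF subset_refl, of j m] by simp_all
        then show ?thesis by simp
      qed (use 0 1 2 3 in simp_all)
    qed
  qed
qed

section \<open>Closed forms of the conditions\<close>

lemma num_claws_2_balance:
  assumes "2 \<le> m"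
  shows "n * (m ^ 2 choose 2) = (k choose 2) * num_claws 2 (K_graph m) \<longleftrightarrow>
    real n = real k * (real k - 1) / (real m + 1)"
proof -
  \<comment> \<open>There are \<open>?c\<close> (m + 1) pairs of points, and
    \<open>K_graph m\<close> has 2 \<open>?c\<close> 2-paths; the 2 cancels the denominator of
    \<open>k choose 2\<close>.\<close>
  let ?c = "real m ^ 2 * (real m - 1) / 2"
  have c: "?c \<noteq> 0" and m: "real m + 1 \<noteq> 0" using assms by simp_all
  have "n * (m ^ 2 choose 2) = (k choose 2) * num_claws 2 (K_graph m) \<longleftrightarrow>
    real (n * (m ^ 2 choose 2)) = real ((k choose 2) * num_claws 2 (K_graph m))"
    by (rule of_nat_eq_iff[symmetric])
  also have "real (n * (m ^ 2 choose 2)) = ?c * (real n * (real m + 1))"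
    by (simp add: real_choose_2 field_simps power2_eq_square)
  also have "real ((k choose 2) * num_claws 2 (K_graph m)) = ?c * (real k * (real k - 1))"
    by (simp add: num_claws_K_graph real_choose_2 field_simps power2_eq_square)
  also have "?c * (real n * (real m + 1)) = ?c * (real k * (real k - 1)) \<longleftrightarrow>
    real n * (real m + 1) = real k * (real k - 1)"
    using c by (metis mult_left_cancel)
  also have "\<dots> \<longleftrightarrow> real n = real k * (real k - 1) / (real m + 1)"
    using m by (rule nonzero_eq_divide_eq[symmetric])
  finally show ?thesis .
qed

lemma num_claws_3_balance:
  assumes "2 \<le> m"
  shows "n * (m ^ 2 choose 3) = (k choose 3) * num_claws 3 (K_graph m) \<longleftrightarrow>
    real n = real k * (real k - 1) * (real k - 2) * (real m - 2) / (3 * (real m + 1) * (real m ^ 2 - 2))"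
proof -
  \<comment> \<open>There are 3 \<open>?c\<close> (m + 1)(m^2 - 2) triples of points, and
    \<open>K_graph m\<close> has 6 \<open>?c\<close> (m - 2) 3-claws; the 6 cancels the denominator
    of \<open>k choose 3\<close>.\<close>
  let ?c = "real m ^ 2 * (real m - 1) / 18"
  \<comment> \<open>The bound makes m^2 - 2 nonzero, as the final division requires.\<close>
  have "2 ^ 2 \<le> real m ^ 2" using assms by (intro power_mono) simp_all
  then have c: "?c \<noteq> 0" and m: "3 * (real m + 1) * (real m ^ 2 - 2) \<noteq> 0" using assms by simp_all
  have "n * (m ^ 2 choose 3) = (k choose 3) * num_claws 3 (K_graph m) \<longleftrightarrow>
    real (n * (m ^ 2 choose 3)) = real ((k choose 3) * num_claws 3 (K_graph m))"
    by (rule of_nat_eq_iff[symmetric])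
  also have "real (n * (m ^ 2 choose 3)) = ?c * (real n * (3 * (real m + 1) * (real m ^ 2 - 2)))"
    by (simp add: real_choose_3 field_simps power2_eq_square)
  also have "real ((k choose 3) * num_claws 3 (K_graph m)) =
      ?c * (real k * (real k - 1) * (real k - 2) * (real m - 2))"
    by (simp add: num_claws_K_graph real_choose_3 field_simps power2_eq_square)
  also have "?c * (real n * (3 * (real m + 1) * (real m ^ 2 - 2))) =
      ?c * (real k * (real k - 1) * (real k - 2) * (real m - 2)) \<longleftrightarrow>
    real n * (3 * (real m + 1) * (real m ^ 2 - 2)) = real k * (real k - 1) * (real k - 2) * (real m - 2)"
    using c by (metis mult_left_cancel)
  also have "\<dots> \<longleftrightarrow>
    real n = real k * (real k - 1) * (real k - 2) * (real m - 2) / (3 * (real m + 1) * (real m ^ 2 - 2))"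
    using m by (rule nonzero_eq_divide_eq[symmetric])
  finally show ?thesis .
qed

lemma num_paths_3_balance:
  assumes "2 \<le> m"
  shows "n * (m ^ 2 choose 3) = (k choose 3) * num_paths 3 (K_graph m) \<longleftrightarrow>
    real n = real k * (real k - 1) * (real k - 2) * (real m - 1) / ((real m + 1) * (real m ^ 2 - 2))"
proof -
  \<comment> \<open>There are \<open>?c\<close> (m + 1)(m^2 - 2) triples of points, and
    \<open>K_graph m\<close> has 6 \<open>?c\<close> (m - 1) 3-paths.\<close>
  let ?c = "real m ^ 2 * (real m - 1) / 6"
  have "2 ^ 2 \<le> real m ^ 2" using assms by (intro power_mono) simp_all
  then have c: "?c \<noteq> 0" and m: "(real m + 1) * (real m ^ 2 - 2) \<noteq> 0" using assms by simp_all
  have "n * (m ^ 2 choose 3) = (k choose 3) * num_paths 3 (K_graph m) \<longleftrightarrow>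
    real (n * (m ^ 2 choose 3)) = real ((k choose 3) * num_paths 3 (K_graph m))"
    by (rule of_nat_eq_iff[symmetric])
  also have "real (n * (m ^ 2 choose 3)) = ?c * (real n * ((real m + 1) * (real m ^ 2 - 2)))"
    by (simp add: real_choose_3 field_simps power2_eq_square)
  also have "real ((k choose 3) * num_paths 3 (K_graph m)) =
      ?c * (real k * (real k - 1) * (real k - 2) * (real m - 1))"
    using assms by (simp add: num_paths_3_K_graph real_choose_3 field_simps power2_eq_square of_nat_diff)
  also have "?c * (real n * ((real m + 1) * (real m ^ 2 - 2))) =
      ?c * (real k * (real k - 1) * (real k - 2) * (real m - 1)) \<longleftrightarrow>
    real n * ((real m + 1) * (real m ^ 2 - 2)) = real k * (real k - 1) * (real k - 2) * (real m - 1)"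
    using c by (metis mult_left_cancel)
  also have "\<dots> \<longleftrightarrow>
    real n = real k * (real k - 1) * (real k - 2) * (real m - 1) / ((real m + 1) * (real m ^ 2 - 2))"
    using m by (rule nonzero_eq_divide_eq[symmetric])
  finally show ?thesis .
qed

section \<open>Closed forms of the replication number\<close>

lemma fact_square_eq:
  assumes "2 \<le> m"
  shows "(fact m :: real) ^ 2 = real m ^ 2 * (real m - 1) * (fact (m - 1) * fact (m - 2))"
proof -
  obtain n where m: "m = Suc (Suc n)" using assms by (metis add_2_eq_Suc le_Suc_ex)
  show ?thesis by (simp add: m power2_eq_square algebra_simps)
qed

lemma replication_formula_2:
  assumes "2 \<le> m"
  shows "2 * fact m ^ 2 * real (k choose 2) / (real (m ^ 2 choose 2) * s) =
    2 * real k * (real k - 1) * fact (m - 1) * fact (m - 2) / ((real m + 1) * s)"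
proof -
  \<comment> \<open>Writing (m!)^2 as m^2 (m - 1) times (m - 1)! (m - 2)! exposes the factor
    \<open>?c\<close> shared by numerator and denominator.\<close>
  let ?c = "real m ^ 2 * (real m - 1) / 2" and ?f = "fact (m - 1) * fact (m - 2) :: real"
  have c: "?c \<noteq> 0" using assms by simp
  have N: "2 * fact m ^ 2 * real (k choose 2) = ?c * (2 * real k * (real k - 1) * fact (m - 1) * fact (m - 2))"
    unfolding fact_square_eq[OF assms] real_choose_2 by (simp add: mult_ac)
  have V: "real (m ^ 2 choose 2) * s = ?c * ((real m + 1) * s)"
    by (simp add: real_choose_2 field_simps power2_eq_square)
  show ?thesis unfolding N V by (rule mult_divide_mult_cancel_left[OF c])
qed

lemma replication_formula_3:
  assumes "2 \<le> m"
  shows "2 * fact m ^ 2 * real (k choose 3) / (real (m ^ 2 choose 3) * s) =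
    2 * real k * (real k - 1) * (real k - 2) * fact (m - 1) * fact (m - 2)
      / ((real m + 1) * (real m ^ 2 - 2) * s)"
proof -
  let ?c = "real m ^ 2 * (real m - 1) / 6"
  have c: "?c \<noteq> 0" using assms by simp
  have N: "2 * fact m ^ 2 * real (k choose 3) =
      ?c * (2 * real k * (real k - 1) * (real k - 2) * fact (m - 1) * fact (m - 2))"
    unfolding fact_square_eq[OF assms] real_choose_3 by (simp add: mult_ac)
  have V: "real (m ^ 2 choose 3) * s = ?c * ((real m + 1) * (real m ^ 2 - 2) * s)"
    by (simp add: real_choose_3 field_simps power2_eq_square)
  show ?thesis unfolding N V by (rule mult_divide_mult_cancel_left[OF c])
qed

theorem theorem3p5:
  fixes m k :: nat and \<Delta> :: "vertex set set" and x y :: "nat \<Rightarrow> nat"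
  assumes "0 < m" and "0 < k"
    and "3 \<le> k" and "real k \<le> real m ^ 2 / 2"
    and "\<Delta> \<subseteq> K_graph m" and "card \<Delta> = k"
    and "\<And>i. x i = vertex_degree \<Delta> (Row i)"
    and "\<And>j. y j = vertex_degree \<Delta> (Col j)"
  shows
    "(is_t_design 2 (D_hat m \<Delta>) \<longleftrightarrow>
        real (num_paths 2 \<Delta>) = real k * (real k - 1) / (real m + 1))
   \<and> (real (num_paths 2 \<Delta>) = real k * (real k - 1) / (real m + 1) \<longleftrightarrow>
        real ((\<Sum>i=1..m. x i choose 2) + (\<Sum>j=1..m. y j choose 2))
          = real k * (real k - 1) / (real m + 1))
   \<and> (real (num_paths 2 \<Delta>) = real k * (real k - 1) / (real m + 1) \<longrightarrow>
        (\<exists>l. is_design 2 (m ^ 2) k l (D_hat m \<Delta>) \<and>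
             real l = 2 * real k * (real k - 1) * fact (m - 1) * fact (m - 2)
                        / ((real m + 1) * real (card (graph_stabilizer m \<Delta>)))))
   \<and> num_claws 3 \<Delta> = (\<Sum>i=1..m. x i choose 3) + (\<Sum>j=1..m. y j choose 3)
   \<and> (is_t_design 3 (D_hat m \<Delta>) \<longleftrightarrow>
        real (num_paths 2 \<Delta>) = real k * (real k - 1) / (real m + 1)
      \<and> real (num_claws 3 \<Delta>)
          = real k * (real k - 1) * (real k - 2) * (real m - 2)
              / (3 * (real m + 1) * (real m ^ 2 - 2))
      \<and> real (num_paths 3 \<Delta>)
          = real k * (real k - 1) * (real k - 2) * (real m - 1)
              / ((real m + 1) * (real m ^ 2 - 2)))
   \<and> (real (num_paths 2 \<Delta>) = real k * (real k - 1) / (real m + 1)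
      \<and> real (num_claws 3 \<Delta>)
          = real k * (real k - 1) * (real k - 2) * (real m - 2)
              / (3 * (real m + 1) * (real m ^ 2 - 2))
      \<and> real (num_paths 3 \<Delta>)
          = real k * (real k - 1) * (real k - 2) * (real m - 1)
              / ((real m + 1) * (real m ^ 2 - 2)) \<longrightarrow>
        (\<exists>l. is_design 3 (m ^ 2) k l (D_hat m \<Delta>) \<and>
             real l = 2 * real k * (real k - 1) * (real k - 2) * fact (m - 1) * fact (m - 2)
                        / ((real m + 1) * (real m ^ 2 - 2)
                            * real (card (graph_stabilizer m \<Delta>)))))"
proof -
  \<comment> \<open>The bounds 3 \<le> k and k \<le> m^2/2 give m^2 \<ge> 6 and hence m \<ge> 2, on
    which the nonzero factors m - 1 and m^2 - 2 rest.\<close>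
  have "real 6 \<le> real (m ^ 2)" using assms(3,4) by simp
  then have m2: "6 \<le> m ^ 2" by (rule of_nat_le_iff[THEN iffD1])
  have m: "2 \<le> m"
  proof (rule ccontr)
    assume "\<not> 2 \<le> m"
    then have "m ^ 2 \<le> 1 ^ 2" by (intro power_mono) simp_all
    with m2 show False by simp
  qed
  note K = assms(5) and k = assms(6)
  have sums: "num_claws u \<Delta> = (\<Sum>i=1..m. x i choose u) + (\<Sum>j=1..m. y j choose u)" if "2 \<le> u" for u
    using num_claws_eq_sum[OF K that] by (simp add: assms(7,8))
  have bal2: "balanced 2 m \<Delta> \<longleftrightarrow> real (num_paths 2 \<Delta>) = real k * (real k - 1) / (real m + 1)"
    unfolding balanced_2_iff[OF K] k num_claws_2_balance[OF m] num_paths_2 ..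
  have bal3: "balanced 3 m \<Delta> \<longleftrightarrow> real (num_paths 2 \<Delta>) = real k * (real k - 1) / (real m + 1)
      \<and> real (num_claws 3 \<Delta>)
          = real k * (real k - 1) * (real k - 2) * (real m - 2)
              / (3 * (real m + 1) * (real m ^ 2 - 2))
      \<and> real (num_paths 3 \<Delta>)
          = real k * (real k - 1) * (real k - 2) * (real m - 1)
              / ((real m + 1) * (real m ^ 2 - 2))"
    unfolding balanced_3_iff[OF K assms(3)[folded k]] k num_claws_2_balance[OF m]
      num_claws_3_balance[OF m] num_paths_3_balance[OF m] num_paths_2 ..
  have "2 \<le> card \<Delta>" "3 \<le> card \<Delta>" using assms(3) k by simp_all
  note design2 = D_hat_design_balanced[OF assms(1) K disjI1[OF refl] this(1), unfolded k bal2 replication_formula_2[OF m]]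
    and design3 = D_hat_design_balanced[OF assms(1) K disjI2[OF refl] this(2), unfolded k bal3 replication_formula_3[OF m]]
  have "num_paths 2 \<Delta> = (\<Sum>i=1..m. x i choose 2) + (\<Sum>j=1..m. y j choose 2)"
    unfolding num_paths_2 by (rule sums) simp
  moreover have "num_claws 3 \<Delta> = (\<Sum>i=1..m. x i choose 3) + (\<Sum>j=1..m. y j choose 3)"
    by (rule sums) simp
  ultimately show ?thesis
    by (intro conjI impI design2 design3) (simp_all only:)
qed

end
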